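(* Let $1\le d<\infty$ be an integer and let $\mathsf d\in\{d_{\mathrm b},d_1\}$ be either the Bures metric or the trace metric on the state space $\mathcal S(\mathbb C^d)$. There is a function $\omega_{d,\mathsf d}:[0,\infty)\to[0,\infty)$ with $\omega_{d,\mathsf d}(\varepsilon)\to0$ as $\varepsilon\to0^+$ such that for every $\varepsilon\ge0$ and every surjective $\varepsilon$-isometry $T:(\mathcal S(\mathbb C^d),\mathsf d)\to(\mathcal S(\mathbb C^d),\mathsf d)$ there is a unitary or antiunitary $U$ on $\mathbb C^d$ with $$\sup_{\rho\in\mathcal S(\mathbb C^d)}\mathsf d\bigl(T(\rho),U\rho U^*\bigr)\le\omega_{d,\mathsf d}(\varepsilon).$$
   Context: $\mathcal S(\mathbb C^d)$ is the set of positive semidefinite $d\times d$ complex matrices of trace one. For positive semidefinite $A,B$: $d_1(A,B)=\|A-B\|_1$ with $\|X\|_1=\operatorname{Tr}|X|$, and $d_{\mathrm b}(A,B)\ge0$ is given by $$d_{\mathrm b}(A,B)^2=\operatorname{Tr}A+\operatorname{Tr}B-2\operatorname{Tr}\bigl[(A^{1/2}BA^{1/2})^{1/2}\bigr].$$ An $\varepsilon$-isometry is a map $T$ (no continuity or affinity assumed) with $|\mathsf d(T(\rho),T(\sigma))-\mathsf d(\rho,\sigma)|\le\varepsilon$ for all states $\rho,\sigma$. A unitary is a linear surjection $U$ with $\langle Ux,Uy\rangle=\langle x,y\rangle$; an antiunitary is a conjugate-linear surjection $U$ with $\langle Ux,Uy\rangle=\overline{\langle x,y\rangle}$; in both cases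 $U^*=U^{-1}$. *)

theory Defs
  imports "HOL-Analysis.Analysis"
begin

definition cinner :: "complex ^ 'n \<Rightarrow> complex ^ 'n \<Rightarrow> complex"
  where "cinner x y = (\<Sum>i\<in>UNIV. cnj (x $ i) * y $ i)"

definition adjoint_matrix :: "complex ^ 'n ^ 'n \<Rightarrow> complex ^ 'n ^ 'n"
  where "adjoint_matrix A = (\<chi> i j. cnj (A $ j $ i))"

definition pos_semidef :: "complex ^ 'n ^ 'n \<Rightarrow> bool"
  where "pos_semidef A \<longleftrightarrow> adjoint_matrix A = A \<and> (\<forall>x. 0 \<le> Re (cinner x (A *v x)))"

definition states :: "(complex ^ 'n ^ 'n) set"
  where "states = {\<rho>. pos_semidef \<rho> \<and> trace \<rho> = 1}"

text \<open>The positive semidefinite square root; meaningful only for positive semidefinite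
  arguments, where it exists and is unique.\<close>

definition psd_sqrt :: "complex ^ 'n ^ 'n \<Rightarrow> complex ^ 'n ^ 'n"
  where "psd_sqrt A = (THE B. pos_semidef B \<and> B ** B = A)"

definition abs_matrix :: "complex ^ 'n ^ 'n \<Rightarrow> complex ^ 'n ^ 'n"
  where "abs_matrix X = psd_sqrt (adjoint_matrix X ** X)"

text \<open>The traces below are of positive semidefinite matrices, hence real;
  \<^const>\<open>Re\<close> only performs the change of type.\<close>

definition trace_norm :: "complex ^ 'n ^ 'n \<Rightarrow> real"
  where "trace_norm X = Re (trace (abs_matrix X))"

definition trace_dist :: "complex ^ 'n ^ 'n \<Rightarrow> complex ^ 'n ^ 'n \<Rightarrow> real"
  where "trace_dist A B = trace_norm (A - B)"

definition bures_dist :: "complex ^ 'n ^ 'n \<Rightarrow> complex ^ 'n ^ 'n \<Rightarrow> real"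
  where "bures_dist A B =
    sqrt (Re (trace A) + Re (trace B)
      - 2 * Re (trace (psd_sqrt (psd_sqrt A ** B ** psd_sqrt A))))"

definition eps_isometry_on ::
    "'a set \<Rightarrow> ('a \<Rightarrow> 'a \<Rightarrow> real) \<Rightarrow> real \<Rightarrow> ('a \<Rightarrow> 'a) \<Rightarrow> bool"
  where "eps_isometry_on S \<delta> \<epsilon> T \<longleftrightarrow>
    T \<in> S \<rightarrow> S \<and> (\<forall>\<rho>\<in>S. \<forall>\<sigma>\<in>S. \<bar>\<delta> (T \<rho>) (T \<sigma>) - \<delta> \<rho> \<sigma>\<bar> \<le> \<epsilon>)"

definition unitary :: "(complex ^ 'n \<Rightarrow> complex ^ 'n) \<Rightarrow> bool"
  where "unitary U \<longleftrightarrow>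
    Vector_Spaces.linear (*s) (*s) U \<and> surj U \<and>
    (\<forall>x y. cinner (U x) (U y) = cinner x y)"

definition conj_linear :: "(complex ^ 'n \<Rightarrow> complex ^ 'n) \<Rightarrow> bool"
  where "conj_linear U \<longleftrightarrow>
    (\<forall>x y. U (x + y) = U x + U y) \<and> (\<forall>c x. U (c *s x) = cnj c *s U x)"

definition antiunitary :: "(complex ^ 'n \<Rightarrow> complex ^ 'n) \<Rightarrow> bool"
  where "antiunitary U \<longleftrightarrow>
    conj_linear U \<and> surj U \<and> (\<forall>x y. cinner (U x) (U y) = cnj (cinner x y))"

text \<open>The matrix of the operator \<open>U \<rho> U\<^sup>*\<close>, where \<open>U\<^sup>* = U\<^sup>-\<^sup>1\<close>. Since \<open>U\<close> may be
  antiunitary it is a map rather than a matrix; the composition is complex linear in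
  either case.\<close>

definition conjugate_by ::
    "(complex ^ 'n \<Rightarrow> complex ^ 'n) \<Rightarrow> complex ^ 'n ^ 'n \<Rightarrow> complex ^ 'n ^ 'n"
  where "conjugate_by U \<rho> = matrix (\<lambda>x. U (\<rho> *v inv U x))"

end

theory Submission
  imports Defs
begin

text \<open>
  Stability follows by compactness from the rigidity of exact isometries. If it failed, there would be maps
  \<open>T n\<close> that are isometric up to \<open>1 / (n + 1)\<close> and all stay at a fixed distance from every unitary or antiunitary
  conjugation. The maps from the compact state space to itself form a compact space, so \<open>T n\<close> converges pointwise along a
  filter to an exact isometry, which is a conjugation by rigidity. Points where \<open>T n\<close> is far from this
  conjugation have limits along a finer filter as well, and rigidity applied to these limits gives the contradiction
  (\<open>near_isometry_stable\<close>). The modulus \<open>\<omega> \<epsilon>\<close> is, up to the summand \<open>\<epsilon>\<close>, the infimum of the admissible bounds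
  (\<open>stability_modulus\<close>).

  Rigidity (\<open>isometry_rigid\<close>) rests on three properties that both metrics share and that are collected
  in the locale \<open>pure_state_metric\<close>. First, two states are at maximal distance exactly when they are orthogonal; an
  isometry therefore maps an orthonormal basis of pure states to mutually orthogonal states, and these are pure because there are
  as many of them as the dimension (\<open>orthogonal_states_pure\<close>). Second, the distance of two pure states
  determines the modulus of the inner product, so Wigner's theorem (\<open>wigner\<close>) yields a unitary or antiunitary \<open>U\<close>
  that induces the isometry on pure states. Third, a state is determined by its distances to the
  pure states. For the Bures metric these distances determine the quadratic form of the state. For the trace metric
  the distance from \<open>\<sigma>\<close> to the pure state of \<open>x\<close> is at least \<open>2 (1 - \<langle>x, \<sigma> x\<rangle>)\<close>, with equality only if \<open>x\<close> is an
  eigenvector (\<open>trace_dist_proj_bound\<close>).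

  The spectral theorem is proved by maximising the Rayleigh quotient. It supplies the existence of
  positive square roots, which are unique and depend continuously on the matrix, so that both metrics are continuous.
\<close>

section \<open>The Hermitian inner product and adjoints\<close>

lemma cinner_add_left: "cinner (x + y) z = cinner x z + cinner y z"
  by (simp add: cinner_def algebra_simps sum.distrib)

lemma cinner_add_right: "cinner x (y + z) = cinner x y + cinner x z"
  by (simp add: cinner_def algebra_simps sum.distrib)

lemma cinner_diff_left: "cinner (x - y) z = cinner x z - cinner y z"
  by (simp add: cinner_def algebra_simps sum_subtractf)

lemma cinner_diff_right: "cinner x (y - z) = cinner x y - cinner x z"
  by (simp add: cinner_def algebra_simps sum_subtractf)

lemma cinner_minus_left: "cinner (- x) z = - cinner x z"
  by (simp add: cinner_def sum_negf)

lemma cinner_minus_right: "cinner x (- z) = - cinner x z"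
  by (simp add: cinner_def sum_negf)

lemma cinner_scale_left: "cinner (c *s x) y = cnj c * cinner x y"
  by (simp add: cinner_def sum_distrib_left mult_ac)

lemma cinner_scale_right: "cinner x (c *s y) = c * cinner x y"
  by (simp add: cinner_def sum_distrib_left mult_ac)

lemma cinner_zero_left: "cinner 0 x = 0"
  by (simp add: cinner_def)

lemma cinner_zero_right: "cinner x 0 = 0"
  by (simp add: cinner_def)

lemma cinner_sum_right: "cinner x (\<Sum>i\<in>I. f i) = (\<Sum>i\<in>I. cinner x (f i))"
  by (induction I rule: infinite_finite_induct) (simp_all add: cinner_zero_right cinner_add_right)

lemmas cinner_simps = cinner_add_left cinner_add_right cinner_diff_left cinner_diff_right
  cinner_minus_left cinner_minus_right cinner_scale_left cinner_scale_right
  cinner_zero_left cinner_zero_right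

lemma cinner_commute: "cinner y x = cnj (cinner x y)"
  by (simp add: cinner_def mult_ac)

lemma mult_cnj_cmod:
  "z * cnj z = (complex_of_real (cmod z))\<^sup>2" "cnj z * z = (complex_of_real (cmod z))\<^sup>2"
  using complex_norm_square[of z] by (simp_all add: mult.commute)

lemma cinner_self: "cinner x x = of_real ((norm x)\<^sup>2)"
proof -
  have "(norm x)\<^sup>2 = (\<Sum>i\<in>UNIV. (cmod (x $ i))\<^sup>2)"
    by (simp add: norm_vec_def L2_set_def sum_nonneg)
  then show ?thesis
    by (simp add: cinner_def mult_cnj_cmod)
qed

lemma cinner_axis_left: "cinner (axis i 1) x = x $ i"
proof -
  have "cinner (axis i 1) x = (\<Sum>j\<in>UNIV. if j = i then x $ j else 0)"
    unfolding cinner_def by (rule sum.cong) (auto simp: axis_def)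
  then show ?thesis
    by simp
qed

lemma norm_scale: "norm (c *s x) = cmod c * norm (x :: complex ^ 'n)"
proof -
  have "complex_of_real ((norm (c *s x))\<^sup>2) = of_real ((cmod c * norm x)\<^sup>2)"
    unfolding cinner_self[symmetric] cinner_simps
    by (simp add: cinner_self power_mult_distrib mult_cnj_cmod mult.assoc[symmetric])
  then have "(norm (c *s x))\<^sup>2 = (cmod c * norm x)\<^sup>2"
    using of_real_eq_iff by blast
  then show ?thesis
    by (simp add: power2_eq_iff_nonneg)
qed

text \<open>The equality case of Cauchy-Schwarz: this is how a vector is recovered, up to a phase,
  from the moduli of inner products.\<close>

lemma cinner_max_imp_phase:
  assumes "norm u = norm v" "cmod (cinner u v) = (norm v)\<^sup>2"
  shows "\<exists>c. cmod c = 1 \<and> u = c *s v"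
proof (cases "v = 0")
  case True
  then show ?thesis
    using assms(1) by (intro exI[of _ 1]) simp
next
  case False
  define c where "c = cinner v u / of_real ((norm v)\<^sup>2)"
  have nz: "norm v \<noteq> 0" "complex_of_real ((norm v)\<^sup>2) \<noteq> 0"
    using False by auto
  have vu: "cinner v u = c * of_real ((norm v)\<^sup>2)"
    using nz by (simp add: c_def)
  have uv: "cinner u v = cnj c * of_real ((norm v)\<^sup>2)"
    by (subst cinner_commute) (simp add: vu)
  have c1: "cmod c = 1"
    using assms(2) nz by (simp add: uv norm_mult norm_power)
  then have cc: "c * cnj c = 1"
    by (simp add: mult_cnj_cmod)
  have "cinner (u - c *s v) (u - c *s v) = of_real ((norm v)\<^sup>2) * (1 - c * cnj c)"
    unfolding cinner_simps uv vu by (simp add: cinner_self assms(1) algebra_simps)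
  then have "u - c *s v = 0"
    by (simp add: cc cinner_self)
  then show ?thesis
    using c1 by auto
qed

lemma adjoint_matrix_involution: "adjoint_matrix (adjoint_matrix A) = A"
  by (simp add: adjoint_matrix_def vec_eq_iff)

lemma adjoint_matrix_add: "adjoint_matrix (A + B) = adjoint_matrix A + adjoint_matrix B"
  by (simp add: adjoint_matrix_def vec_eq_iff)

lemma adjoint_matrix_diff: "adjoint_matrix (A - B) = adjoint_matrix A - adjoint_matrix B"
  by (simp add: adjoint_matrix_def vec_eq_iff)

lemma adjoint_matrix_mult:
  "adjoint_matrix (A ** B) = adjoint_matrix B ** adjoint_matrix (A :: complex ^ 'n ^ 'n)"
  by (simp add: adjoint_matrix_def vec_eq_iff matrix_matrix_mult_def mult_ac)

lemma adjoint_matrix_scaleR: "adjoint_matrix (r *\<^sub>R A) = r *\<^sub>R adjoint_matrix A"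
  by (simp add: adjoint_matrix_def vec_eq_iff)

lemma adjoint_matrix_zero: "adjoint_matrix 0 = 0"
  by (simp add: adjoint_matrix_def vec_eq_iff)

lemma adjoint_matrix_sum: "adjoint_matrix (\<Sum>i\<in>I. f i) = (\<Sum>i\<in>I. adjoint_matrix (f i))"
  by (induction I rule: infinite_finite_induct)
    (simp_all add: adjoint_matrix_zero adjoint_matrix_add)

lemma cinner_matrix_right:
  fixes A :: "complex ^ 'n ^ 'n"
  shows "cinner x (A *v y) = cinner (adjoint_matrix A *v x) y"
proof -
  have "cinner x (A *v y) = (\<Sum>i\<in>UNIV. \<Sum>j\<in>UNIV. cnj (x $ i) * (A $ i $ j * y $ j))"
    by (simp add: cinner_def matrix_vector_mult_def sum_distrib_left)
  also have "\<dots> = (\<Sum>j\<in>UNIV. \<Sum>i\<in>UNIV. cnj (x $ i) * (A $ i $ j * y $ j))"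
    by (rule sum.swap)
  also have "\<dots> = cinner (adjoint_matrix A *v x) y"
    by (simp add: cinner_def matrix_vector_mult_def adjoint_matrix_def sum_distrib_left
        mult_ac)
  finally show ?thesis .
qed

lemma hermitian_cinner:
  fixes A :: "complex ^ 'n ^ 'n"
  assumes "adjoint_matrix A = A"
  shows "cinner (A *v x) y = cinner x (A *v y)"
  using cinner_matrix_right[of x A y] assms by simp

lemma hermitian_form_real:
  fixes A :: "complex ^ 'n ^ 'n"
  assumes "adjoint_matrix A = A"
  shows "cinner x (A *v x) = of_real (Re (cinner x (A *v x)))"
proof -
  have "cnj (cinner x (A *v x)) = cinner x (A *v x)"
    using hermitian_cinner[OF assms] cinner_commute by metis
  then show ?thesis
    by (metis Reals_cnj_iff of_real_Re)
qed

lemma matrix_mult_zero: "0 ** A = (0 :: complex ^ 'n ^ 'n)" "A ** 0 = (0 :: complex ^ 'n ^ 'n)"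
  by (simp_all add: vec_eq_iff matrix_matrix_mult_def)

lemma matrix_scaleR_mult_left: "(r *\<^sub>R A) ** B = r *\<^sub>R (A ** (B :: complex ^ 'n ^ 'n))"
  by (simp add: vec_eq_iff matrix_matrix_mult_def scaleR_sum_right)

lemma matrix_scaleR_mult_right: "A ** (r *\<^sub>R B) = r *\<^sub>R (A ** (B :: complex ^ 'n ^ 'n))"
  by (simp add: vec_eq_iff matrix_matrix_mult_def scaleR_sum_right)

lemma matrix_add_mult_left: "(A + B) ** C = A ** C + B ** (C :: complex ^ 'n ^ 'n)"
  by (simp add: vec_eq_iff matrix_matrix_mult_def algebra_simps sum.distrib)

lemma matrix_diff_mult_left: "(A - B) ** C = A ** C - B ** (C :: complex ^ 'n ^ 'n)"
  by (simp add: vec_eq_iff matrix_matrix_mult_def algebra_simps sum_subtractf)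

lemma matrix_diff_mult_right: "C ** (A - B) = C ** A - C ** (B :: complex ^ 'n ^ 'n)"
  by (simp add: vec_eq_iff matrix_matrix_mult_def algebra_simps sum_subtractf)

lemma matrix_scaleR_vector: "(r *\<^sub>R A) *v x = of_real r *s (A *v (x :: complex ^ 'n))"
  by (simp add: vec_eq_iff matrix_vector_mult_def sum_distrib_left scaleR_conv_of_real[where 'a=complex] mult_ac)

lemma matrix_sum_vector: "(\<Sum>i\<in>I. f i) *v x = (\<Sum>i\<in>I. f i *v (x :: complex ^ 'n))"
  by (induction I rule: infinite_finite_induct)
    (simp_all add: matrix_vector_mult_add_rdistrib)

lemma matrix_vector_scale: "A *v (c *s x) = c *s (A *v (x :: complex ^ 'n))"
  by (simp add: vec_eq_iff matrix_vector_mult_def sum_distrib_left mult_ac)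

lemma matrix_vector_sum: "A *v (\<Sum>i\<in>I. f i) = (\<Sum>i\<in>I. A *v (f i :: complex ^ 'n))"
  by (induction I rule: infinite_finite_induct) (simp_all add: matrix_vector_right_distrib)

lemma trace_zero: "trace (0 :: complex ^ 'n ^ 'n) = 0"
  by (simp add: trace_def)

lemma trace_scaleR: "trace (r *\<^sub>R A) = of_real r * trace (A :: complex ^ 'n ^ 'n)"
  by (simp add: trace_def sum_distrib_left scaleR_conv_of_real[where 'a=complex])

lemma trace_sum_matrix: "trace (\<Sum>i\<in>I. f i) = (\<Sum>i\<in>I. trace (f i :: complex ^ 'n ^ 'n))"
  by (induction I rule: infinite_finite_induct) (simp_all add: trace_zero trace_add)

text \<open>The norm of the type of matrices is the Hilbert-Schmidt norm.\<close>

lemma norm_matrix_trace: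
  "trace (adjoint_matrix A ** A) = of_real ((norm (A :: complex ^ 'n ^ 'n))\<^sup>2)"
proof -
  have "(norm A)\<^sup>2 = (\<Sum>i\<in>UNIV. \<Sum>j\<in>UNIV. (cmod (A $ i $ j))\<^sup>2)"
    by (simp add: norm_vec_def L2_set_def sum_nonneg)
  also have "\<dots> = (\<Sum>j\<in>UNIV. \<Sum>i\<in>UNIV. (cmod (A $ i $ j))\<^sup>2)"
    by (rule sum.swap)
  finally show ?thesis
    by (simp add: trace_def matrix_matrix_mult_def adjoint_matrix_def mult_cnj_cmod)
qed

lemma gram_eq_zero:
  assumes "adjoint_matrix A ** A = 0"
  shows "A = (0 :: complex ^ 'n ^ 'n)"
  using norm_matrix_trace[of A] assms by (simp add: trace_zero)

section \<open>Orthonormal bases and diagonal operators\<close>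

definition orthonormal :: "('n \<Rightarrow> complex ^ 'n) \<Rightarrow> bool"
  where "orthonormal b \<longleftrightarrow> (\<forall>i j. cinner (b i) (b j) = (if i = j then 1 else 0))"

text \<open>For a unit vector \<open>x\<close> this is the pure state supported by \<open>x\<close>.\<close>

definition proj :: "complex ^ 'n \<Rightarrow> complex ^ 'n ^ 'n"
  where "proj x = (\<chi> i j. x $ i * cnj (x $ j))"

definition diag_in :: "('n \<Rightarrow> complex ^ 'n) \<Rightarrow> ('n \<Rightarrow> real) \<Rightarrow> complex ^ 'n ^ 'n"
  where "diag_in b \<mu> = (\<Sum>i\<in>UNIV. \<mu> i *\<^sub>R proj (b i))"

lemma proj_vector: "proj x *v y = cinner x y *s x"
  by (simp add: proj_def vec_eq_iff matrix_vector_mult_def cinner_def sum_distrib_left mult_ac)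

lemma adjoint_matrix_proj: "adjoint_matrix (proj x) = proj x"
  by (simp add: proj_def adjoint_matrix_def vec_eq_iff mult_ac)

lemma trace_proj: "trace (proj x) = of_real ((norm x)\<^sup>2)"
  unfolding cinner_self[symmetric] by (simp add: trace_def proj_def cinner_def mult_ac)

lemma proj_phase: "cmod c = 1 \<Longrightarrow> proj (c *s x) = proj x"
  by (simp add: proj_def vec_eq_iff complex_norm_square[symmetric] mult_ac)

lemma matrix_proj_matrix:
  fixes A :: "complex ^ 'n ^ 'n"
  shows "A ** proj x ** adjoint_matrix A = proj (A *v x)"
  by (simp add: matrix_eq matrix_vector_mul_assoc[symmetric] proj_vector matrix_vector_scale
      cinner_matrix_right adjoint_matrix_involution)

lemma pos_semidef_proj: "pos_semidef (proj x)"
proof -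
  have "cinner y (proj x *v y) = of_real ((cmod (cinner x y))\<^sup>2)" for y
    by (simp add: proj_vector cinner_simps cinner_commute[of y x] mult_cnj_cmod)
  then show ?thesis
    by (simp add: pos_semidef_def adjoint_matrix_proj)
qed

lemma proj_in_states: "norm x = 1 \<Longrightarrow> proj x \<in> states"
  by (simp add: states_def pos_semidef_proj trace_proj)

lemma orthonormal_norm: "orthonormal b \<Longrightarrow> norm (b i) = 1"
  using cinner_self[of "b i"] unfolding orthonormal_def
  by (metis norm_ge_zero of_real_eq_1_iff power2_eq_1_iff  neg_0_le_iff_le not_one_le_zero)

lemma orthonormal_columns:
  fixes b :: "'n \<Rightarrow> complex ^ 'n"
  assumes "orthonormal b"
  defines "V \<equiv> (\<chi> i j. b j $ i)"
  shows "adjoint_matrix V ** V = mat 1" "V ** adjoint_matrix V = mat 1"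
proof -
  have "(adjoint_matrix V ** V) $ i $ j = cinner (b i) (b j)" for i j
    by (simp add: V_def adjoint_matrix_def matrix_matrix_mult_def cinner_def)
  then show "adjoint_matrix V ** V = mat 1"
    using assms(1) by (simp add: vec_eq_iff mat_def orthonormal_def)
  then show "V ** adjoint_matrix V = mat 1"
    using matrix_left_right_inverse by blast
qed

text \<open>A family indexed by the coordinates themselves has the right length, so orthonormality
  alone makes it a basis.\<close>

lemma orthonormal_expand:
  fixes b :: "'n \<Rightarrow> complex ^ 'n"
  assumes "orthonormal b"
  shows "x = (\<Sum>i\<in>UNIV. cinner (b i) x *s b i)"
proof -
  define V :: "complex ^ 'n ^ 'n" where "V = (\<chi> i j. b j $ i)"
  have "V ** adjoint_matrix V = mat 1"
    using orthonormal_columns[OF assms] by (simp add: V_def)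
  then have "x = V *v (adjoint_matrix V *v x)"
    by (simp add: matrix_vector_mul_assoc)
  moreover have "(adjoint_matrix V *v x) $ i = cinner (b i) x" for i
    by (simp add: V_def adjoint_matrix_def matrix_vector_mult_def cinner_def)
  ultimately show ?thesis
    by (subst (asm) matrix_mult_sum) (simp add: V_def column_def vec_eq_iff)
qed

lemma orthonormal_eqI:
  assumes "orthonormal b" "\<And>i. A *v b i = B *v b i"
  shows "A = (B :: complex ^ 'n ^ 'n)"
proof -
  have "A *v x = B *v x" for x
    by (subst (1 2) orthonormal_expand[OF assms(1), of x])
      (simp add: matrix_vector_sum matrix_vector_scale assms(2))
  then show ?thesis
    by (simp add: matrix_eq)
qed

lemma orthonormal_parseval:
  assumes "orthonormal b"
  shows "(\<Sum>i\<in>UNIV. (cmod (cinner (b i) x))\<^sup>2) = (norm x)\<^sup>2"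
proof -
  have "complex_of_real ((norm x)\<^sup>2) = cinner x (\<Sum>i\<in>UNIV. cinner (b i) x *s b i)"
    using orthonormal_expand[OF assms] cinner_self by metis
  also have "\<dots> = of_real (\<Sum>i\<in>UNIV. (cmod (cinner (b i) x))\<^sup>2)"
    by (simp add: cinner_sum_right cinner_simps cinner_commute[of x] mult_cnj_cmod mult.assoc)
  finally show ?thesis
    using of_real_eq_iff by metis
qed

lemma trace_orthonormal:
  fixes b :: "'n \<Rightarrow> complex ^ 'n"
  assumes "orthonormal b"
  shows "trace A = (\<Sum>i\<in>UNIV. cinner (b i) (A *v b i))"
proof -
  define V :: "complex ^ 'n ^ 'n" where "V = (\<chi> i j. b j $ i)"
  have V: "V ** adjoint_matrix V = mat 1"
    using orthonormal_columns[OF assms] by (simp add: V_def)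
  have b: "b i = V *v axis i 1" for i
    by (simp add: V_def vec_eq_iff matrix_vector_mult_def axis_def if_distrib cong: if_cong)
  have "cinner (b i) (A *v b i) = (adjoint_matrix V ** (A ** V)) $ i $ i" for i
  proof -
    have "cinner (b i) (A *v b i) = cinner (axis i 1) (adjoint_matrix V *v (A *v (V *v axis i 1)))"
      by (simp add: b cinner_matrix_right adjoint_matrix_involution)
    also have "\<dots> = ((adjoint_matrix V ** (A ** V)) *v axis i 1) $ i"
      by (simp add: cinner_axis_left matrix_vector_mul_assoc matrix_mul_assoc)
    finally show ?thesis
      by (simp add: matrix_vector_mult_def axis_def if_distrib cong: if_cong)
  qed
  then have "(\<Sum>i\<in>UNIV. cinner (b i) (A *v b i)) = trace (adjoint_matrix V ** (A ** V))"
    by (simp add: trace_def)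
  also have "\<dots> = trace ((A ** V) ** adjoint_matrix V)"
    by (rule trace_mul_sym)
  finally show ?thesis
    by (simp add: matrix_mul_assoc[symmetric] V)
qed

lemma diag_in_basis:
  assumes "orthonormal b"
  shows "diag_in b \<mu> *v b j = of_real (\<mu> j) *s b j"
proof -
  have "diag_in b \<mu> *v b j = (\<Sum>i\<in>UNIV. if i = j then of_real (\<mu> j) *s b j else 0)"
    using assms unfolding diag_in_def matrix_sum_vector orthonormal_def
    by (intro sum.cong) (auto simp: matrix_scaleR_vector proj_vector)
  then show ?thesis
    by simp
qed

lemma diag_in_eqI:
  assumes "orthonormal b" "\<And>i. A *v b i = of_real (\<mu> i) *s b i"
  shows "A = diag_in b \<mu>"
  using assms by (intro orthonormal_eqI[of b]) (simp_all add: diag_in_basis)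

lemma diag_in_mult:
  "orthonormal b \<Longrightarrow> diag_in b \<mu> ** diag_in b \<nu> = diag_in b (\<lambda>i. \<mu> i * \<nu> i)"
  by (rule diag_in_eqI)
    (simp_all add: matrix_vector_mul_assoc[symmetric] diag_in_basis matrix_vector_scale mult_ac)

lemma adjoint_matrix_diag_in: "adjoint_matrix (diag_in b \<mu>) = diag_in b \<mu>"
  by (simp add: diag_in_def adjoint_matrix_sum adjoint_matrix_scaleR adjoint_matrix_proj)

lemma trace_diag_in: "orthonormal b \<Longrightarrow> trace (diag_in b \<mu>) = of_real (\<Sum>i\<in>UNIV. \<mu> i)"
  by (simp add: diag_in_def trace_sum_matrix trace_scaleR trace_proj orthonormal_norm)

lemma diag_in_form:
  "cinner x (diag_in b \<mu> *v x) = of_real (\<Sum>i\<in>UNIV. \<mu> i * (cmod (cinner (b i) x))\<^sup>2)"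
  by (simp add: diag_in_def matrix_sum_vector matrix_scaleR_vector proj_vector cinner_sum_right
      cinner_simps cinner_commute[of x] mult_cnj_cmod mult.assoc)

lemma pos_semidef_diag_in:
  assumes "\<And>i. 0 \<le> \<mu> i"
  shows "pos_semidef (diag_in b \<mu>)"
  by (simp add: pos_semidef_def adjoint_matrix_diag_in diag_in_form sum_nonneg assms)

section \<open>The spectral theorem\<close>

lemma continuous_on_cinner [continuous_intros]:
  "continuous_on S f \<Longrightarrow> continuous_on S g \<Longrightarrow> continuous_on S (\<lambda>x. cinner (f x) (g x))"
  unfolding cinner_def by (intro continuous_intros)

lemma continuous_on_matrix_vector [continuous_intros]:
  fixes f :: "'a::topological_space \<Rightarrow> complex ^ 'n ^ 'n"
  shows "continuous_on S f \<Longrightarrow> continuous_on S g \<Longrightarrow> continuous_on S (\<lambda>x. f x *v g x)"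
  unfolding matrix_vector_mult_def by (intro continuous_intros)

text \<open>A square matrix with a zero row has a nontrivial kernel.\<close>

lemma exists_orthogonal_vector:
  fixes b :: "'n \<Rightarrow> complex ^ 'n"
  assumes "k \<notin> I"
  shows "\<exists>x. x \<noteq> 0 \<and> (\<forall>i\<in>I. cinner (b i) x = 0)"
proof -
  define M :: "complex ^ 'n ^ 'n" where "M = (\<chi> i j. if i \<in> I then cnj (b i $ j) else 0)"
  have "\<nexists>B. B ** M = mat 1"
  proof
    assume "\<exists>B. B ** M = mat 1"
    then obtain B where "M ** B = mat 1"
      using matrix_left_right_inverse by blast
    moreover have "(M ** B) $ k $ k = 0"
      using assms by (simp add: M_def matrix_matrix_mult_def)
    ultimately show False
      by (simp add: mat_def)
  qed
  then obtain x where x: "x \<noteq> 0" "M *v x = 0"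
    using matrix_left_invertible_ker[of M] by blast
  have "cinner (b i) x = (M *v x) $ i" if "i \<in> I" for i
    using that by (simp add: M_def matrix_vector_mult_def cinner_def)
  then show ?thesis
    using x by auto
qed

lemma quadratic_bound_imp_zero:
  fixes N C :: real
  assumes "0 \<le> N" "\<And>t. 2 * t * N \<le> t\<^sup>2 * C"
  shows "N = 0"
proof (rule ccontr)
  assume "N \<noteq> 0"
  then have N: "0 < N"
    using assms(1) by simp
  define t where "t = N / (\<bar>C\<bar> + 1)"
  have t: "0 < t" "t * (\<bar>C\<bar> + 1) = N"
    using N by (simp_all add: t_def)
  have "t * (2 * N) \<le> t * (t * C)"
    using assms(2)[of t] by (simp add: power2_eq_square mult_ac)
  then have "2 * N \<le> t * C"
    using t(1) by simp
  also have "\<dots> \<le> t * (\<bar>C\<bar> + 1)"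
    using t(1) by (intro mult_left_mono) auto
  finally show False
    using t N by simp
qed

text \<open>A maximiser of the Rayleigh quotient on the orthogonal complement of the eigenvectors
  already found is a new eigenvector: the first variation in the direction of its own
  residual \<open>A x - \<mu> x\<close>, which again lies in the complement, is twice the squared length of the residual.\<close>

lemma next_eigenvector:
  fixes A :: "complex ^ 'n ^ 'n" and b :: "'n \<Rightarrow> complex ^ 'n"
  assumes A: "adjoint_matrix A = A" and "k \<notin> I"
    and eig: "\<And>i. i \<in> I \<Longrightarrow> A *v b i = complex_of_real (\<mu> i) *s b i"
  shows "\<exists>x m. norm x = 1 \<and> (\<forall>i\<in>I. cinner (b i) x = 0) \<and> A *v x = complex_of_real m *s x"
proof -
  define W where "W = {x. \<forall>i\<in>I. cinner (b i) x = 0}"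
  define q where "q x = Re (cinner x (A *v x))" for x
  have W_scale: "c *s x \<in> W" if "x \<in> W" for c x
    using that by (simp add: W_def cinner_simps)
  have W_add: "x + y \<in> W" "x - y \<in> W" if "x \<in> W" "y \<in> W" for x y
    using that by (simp_all add: W_def cinner_simps)
  have W_A: "A *v x \<in> W" if "x \<in> W" for x
  proof -
    have "cinner (b i) (A *v x) = 0" if "i \<in> I" for i
      using \<open>x \<in> W\<close> that
      by (simp add: hermitian_cinner[OF A, symmetric] eig cinner_simps W_def)
    then show ?thesis
      by (simp add: W_def)
  qed
  have q_scale: "q (complex_of_real c *s x) = c\<^sup>2 * q x" for c x
    by (simp add: q_def matrix_vector_scale cinner_simps power2_eq_square)
  define S where "S = W \<inter> sphere 0 1"
  have "W = (\<Inter>i\<in>I. {x. cinner (b i) x = 0})"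
    by (auto simp: W_def)
  then have "closed W"
    by (auto intro!: closed_INT closed_Collect_eq continuous_intros)
  then have "compact S"
    unfolding S_def by (intro closed_Int_compact) auto
  obtain x0 where x0: "x0 \<noteq> 0" "x0 \<in> W"
    using exists_orthogonal_vector[OF assms(2), of b] by (auto simp: W_def)
  have normalise: "complex_of_real (1 / norm w) *s w \<in> S" if "w \<noteq> 0" "w \<in> W" for w
    using that W_scale by (auto simp: S_def norm_scale norm_divide)
  then have "S \<noteq> {}"
    using x0 by blast
  have "continuous_on S q"
    unfolding q_def by (intro continuous_intros)
  then obtain x where x: "x \<in> S" "\<And>y. y \<in> S \<Longrightarrow> q y \<le> q x"
    using continuous_attains_sup[OF \<open>compact S\<close> \<open>S \<noteq> {}\<close>] by blast
  define m where "m = q x"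
  have bound: "q w \<le> m * (norm w)\<^sup>2" if "w \<in> W" for w
  proof (cases "w = 0")
    case True
    then show ?thesis
      by (simp add: q_def cinner_simps)
  next
    case False
    then have "q w / (norm w)\<^sup>2 \<le> m"
      using x(2)[OF normalise[OF False that]] by (simp only: q_scale m_def) (simp add: power_divide)
    then show ?thesis
      using False by (simp add: field_simps)
  qed
  have xW: "x \<in> W" and x1: "norm x = 1"
    using x(1) by (auto simp: S_def)
  define y where "y = A *v x - complex_of_real m *s x"
  have yW: "y \<in> W"
    unfolding y_def by (intro W_add W_A W_scale xW)
  define r where "r = Re (cinner x y)"
  have ryx: "Re (cinner y x) = r"
    using cinner_commute[of y x] by (simp add: r_def)
  have Ax: "A *v x = y + complex_of_real m *s x"
    by (simp add: y_def)
  have yAx: "Re (cinner y (A *v x)) = (norm y)\<^sup>2 + m * r"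
    unfolding Ax by (simp add: cinner_simps cinner_self ryx)
  have xAy: "Re (cinner x (A *v y)) = (norm y)\<^sup>2 + m * r"
    using yAx cinner_commute[of "A *v x" y] hermitian_cinner[OF A, of x y] by simp
  have "2 * t * (norm y)\<^sup>2 \<le> t\<^sup>2 * (m * (norm y)\<^sup>2 - q y)" for t
  proof -
    let ?w = "x + complex_of_real t *s y"
    have "q ?w = m + 2 * t * ((norm y)\<^sup>2 + m * r) + t\<^sup>2 * q y"
      by (simp add: q_def m_def matrix_vector_right_distrib matrix_vector_scale cinner_simps
          yAx xAy power2_eq_square algebra_simps)
    moreover have "(norm ?w)\<^sup>2 = Re (cinner ?w ?w)"
      by (simp add: cinner_self)
    then have "(norm ?w)\<^sup>2 = 1 + 2 * t * r + t\<^sup>2 * (norm y)\<^sup>2"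
      by (simp only: cinner_simps)
        (simp add: cinner_self ryx x1 r_def[symmetric] power2_eq_square algebra_simps)
    moreover have "q ?w \<le> m * (norm ?w)\<^sup>2"
      by (intro bound W_add W_scale xW yW)
    ultimately show ?thesis
      by (simp add: algebra_simps)
  qed
  then have "(norm y)\<^sup>2 = 0"
    by (rule quadratic_bound_imp_zero[OF zero_le_power2])
  then have "A *v x = complex_of_real m *s x"
    using Ax by simp
  then show ?thesis
    using xW x1 by (auto simp: W_def)
qed

lemma partial_eigenbasis:
  fixes A :: "complex ^ 'n ^ 'n" and I :: "'n set"
  assumes A: "adjoint_matrix A = A" and "finite I"
  shows "\<exists>b \<mu>. (\<forall>i\<in>I. \<forall>j\<in>I. cinner (b i) (b j) = (if i = j then 1 else 0)) \<and>
    (\<forall>i\<in>I. A *v b i = complex_of_real (\<mu> i) *s (b i :: complex ^ 'n))"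
  using \<open>finite I\<close>
proof (induction I)
  case empty
  then show ?case
    by simp
next
  case (insert k I)
  then obtain b \<mu> where b: "\<forall>i\<in>I. \<forall>j\<in>I. cinner (b i) (b j) = (if i = j then 1 else 0)"
    and eig: "\<forall>i\<in>I. A *v b i = complex_of_real (\<mu> i) *s (b i :: complex ^ 'n)"
    by blast
  obtain x m where x: "norm x = 1" "\<forall>i\<in>I. cinner (b i) x = 0" "A *v x = complex_of_real m *s x"
    using next_eigenvector[OF A insert.hyps(2), of b \<mu>] eig by blast
  have "\<forall>i\<in>I. cinner x (b i) = 0"
    using x(2) by (subst cinner_commute) simp
  moreover have "cinner x x = 1"
    using x(1) by (simp add: cinner_self)
  ultimately show ?case
    using b eig x insert.hyps(2)
    by (intro exI[of _ "b(k := x)"] exI[of _ "\<mu>(k := m)"]) auto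
qed

theorem spectral_theorem:
  fixes A :: "complex ^ 'n ^ 'n"
  assumes "adjoint_matrix A = A"
  obtains b \<mu> where "orthonormal b" "A = diag_in b \<mu>"
proof -
  obtain b :: "'n \<Rightarrow> complex ^ 'n" and \<mu> where "orthonormal b"
    "\<And>i. A *v b i = complex_of_real (\<mu> i) *s b i"
    using partial_eigenbasis[OF assms finite[of UNIV]] by (auto simp: orthonormal_def)
  then show thesis
    using that diag_in_eqI by blast
qed

section \<open>Positive semidefinite matrices and their square roots\<close>

lemma pos_semidef_hermitian: "pos_semidef A \<Longrightarrow> adjoint_matrix A = A"
  by (simp add: pos_semidef_def)

lemma pos_semidef_diagonalise:
  fixes A :: "complex ^ 'n ^ 'n"
  assumes "pos_semidef A"
  obtains b \<mu> where "orthonormal b" "A = diag_in b \<mu>" "\<And>i. 0 \<le> \<mu> i"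
proof -
  obtain b \<mu> where b: "orthonormal b" "A = diag_in b \<mu>"
    using spectral_theorem[OF pos_semidef_hermitian[OF assms]] by blast
  have "0 \<le> \<mu> i" for i
  proof -
    have "0 \<le> Re (cinner (b i) (A *v b i))"
      using assms by (simp add: pos_semidef_def)
    then show ?thesis
      using b by (simp add: diag_in_basis cinner_simps) (simp add: orthonormal_def)
  qed
  then show thesis
    using b that by blast
qed

lemma pos_semidef_zero: "pos_semidef 0"
  by (simp add: pos_semidef_def adjoint_matrix_zero cinner_simps)

lemma pos_semidef_gram: "pos_semidef (adjoint_matrix A ** (A :: complex ^ 'n ^ 'n))"
proof -
  have "cinner x ((adjoint_matrix A ** A) *v x) = cinner (A *v x) (A *v x)" for x
    by (simp add: matrix_vector_mul_assoc[symmetric] cinner_matrix_right adjoint_matrix_involution)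
  then show ?thesis
    by (simp add: pos_semidef_def adjoint_matrix_mult adjoint_matrix_involution cinner_self)
qed

lemma pos_semidef_sandwich:
  fixes A B :: "complex ^ 'n ^ 'n"
  assumes "pos_semidef A" "pos_semidef B"
  shows "pos_semidef (B ** A ** B)"
proof -
  note B = pos_semidef_hermitian[OF assms(2)]
  have "cinner x ((B ** A ** B) *v x) = cinner (B *v x) (A *v (B *v x))" for x
    by (simp add: matrix_vector_mul_assoc[symmetric] hermitian_cinner[OF B])
  then show ?thesis
    using assms by (simp add: pos_semidef_def adjoint_matrix_mult matrix_mul_assoc)
qed

lemma pos_semidef_scaleR: "pos_semidef A \<Longrightarrow> 0 \<le> r \<Longrightarrow> pos_semidef (r *\<^sub>R A)"
  by (simp add: pos_semidef_def adjoint_matrix_scaleR matrix_scaleR_vector cinner_simps)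

lemma pos_semidef_trace_zero:
  fixes A :: "complex ^ 'n ^ 'n"
  assumes "pos_semidef A" "Re (trace A) = 0"
  shows "A = 0"
proof -
  obtain b \<mu> where b: "orthonormal b" "A = diag_in b \<mu>" "\<And>i. 0 \<le> \<mu> i"
    using pos_semidef_diagonalise[OF assms(1)] by blast
  have "(\<Sum>i\<in>UNIV. \<mu> i) = 0"
    using assms(2) b by (simp add: trace_diag_in)
  then have "\<mu> i = 0" for i
    using b(3) by (simp add: sum_nonneg_eq_0_iff)
  then show ?thesis
    by (simp add: b(2) diag_in_def)
qed

text \<open>On an eigenvector of one square root with eigenvalue \<open>\<lambda>\<close>, the residual of the other root
  is an eigenvector for \<open>- \<lambda>\<close>, which positivity excludes unless \<open>\<lambda> = 0\<close>.\<close>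

lemma pos_semidef_sqrt_unique:
  fixes B C :: "complex ^ 'n ^ 'n"
  assumes "pos_semidef B" "pos_semidef C" "B ** B = C ** C"
  shows "C = B"
proof -
  obtain b \<mu> where b: "orthonormal b" "B = diag_in b \<mu>" "\<And>i. 0 \<le> \<mu> i"
    using pos_semidef_diagonalise[OF assms(1)] by blast
  note C = pos_semidef_hermitian[OF assms(2)]
  have "C *v b i = complex_of_real (\<mu> i) *s b i" for i
  proof -
    let ?m = "complex_of_real (\<mu> i)"
    let ?w = "C *v b i - ?m *s b i"
    have Bb: "B *v b i = ?m *s b i"
      by (simp add: b diag_in_basis)
    have CC: "C *v (C *v b i) = ?m *s (?m *s b i)"
      using assms(3) Bb by (simp add: matrix_vector_mul_assoc)
        (metis Bb matrix_vector_mul_assoc matrix_vector_scale vector_smult_assoc)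
    have Cw: "C *v ?w = - (?m *s ?w)"
      by (simp add: matrix_vector_mult_diff_distrib CC matrix_vector_scale vector_ssub_ldistrib)
    have "0 \<le> Re (cinner ?w (C *v ?w))"
      using assms(2) by (simp add: pos_semidef_def)
    then have "\<mu> i * (norm ?w)\<^sup>2 \<le> 0"
      unfolding Cw by (simp only: cinner_minus_right cinner_scale_right cinner_self) simp
    then have "\<mu> i = 0 \<or> ?w = 0"
      using b(3)[of i]
      by (smt (verit, best) mult_pos_pos zero_less_norm_iff zero_less_power)
    moreover have "?w = 0" if "\<mu> i = 0"
    proof -
      have "cinner (C *v b i) (C *v b i) = 0"
        using CC that by (simp add: hermitian_cinner[OF C] cinner_simps)
      then show ?thesis
        using that by (simp add: cinner_self)
    qed
    ultimately show ?thesis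
      by auto
  qed
  then show ?thesis
    using diag_in_eqI[OF b(1)] b(2) by blast
qed

lemma psd_sqrt_eqI:
  assumes "pos_semidef B" "B ** B = A"
  shows "psd_sqrt A = B"
  unfolding psd_sqrt_def using assms pos_semidef_sqrt_unique by (intro the_equality) auto

lemma psd_sqrt:
  fixes A :: "complex ^ 'n ^ 'n"
  assumes "pos_semidef A"
  shows "pos_semidef (psd_sqrt A)" "psd_sqrt A ** psd_sqrt A = A"
proof -
  obtain b \<mu> where b: "orthonormal b" "A = diag_in b \<mu>" "\<And>i. 0 \<le> \<mu> i"
    using pos_semidef_diagonalise[OF assms] by blast
  let ?B = "diag_in b (\<lambda>i. sqrt (\<mu> i))"
  have "pos_semidef ?B" "?B ** ?B = A"
    using b by (simp_all add: pos_semidef_diag_in diag_in_mult)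
  then show "pos_semidef (psd_sqrt A)" "psd_sqrt A ** psd_sqrt A = A"
    using psd_sqrt_eqI by metis+
qed

lemma psd_sqrt_of_square: "pos_semidef B \<Longrightarrow> psd_sqrt (B ** B) = B"
  by (simp add: psd_sqrt_eqI)

lemma psd_sqrt_zero: "psd_sqrt 0 = 0"
  using psd_sqrt_of_square[OF pos_semidef_zero] by simp

lemma psd_sqrt_vector_norm:
  assumes "pos_semidef A"
  shows "Re (cinner x (A *v x)) = (norm (psd_sqrt A *v x))\<^sup>2"
proof -
  note B = psd_sqrt[OF assms]
  have "cinner x (A *v x) = cinner x (psd_sqrt A *v (psd_sqrt A *v x))"
    using B(2) by (simp add: matrix_vector_mul_assoc)
  also have "\<dots> = cinner (psd_sqrt A *v x) (psd_sqrt A *v x)"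
    using hermitian_cinner[OF pos_semidef_hermitian[OF B(1)]] by simp
  finally show ?thesis
    by (simp add: cinner_self)
qed

lemma pos_semidef_form_zero:
  assumes "pos_semidef A" "Re (cinner x (A *v x)) = 0"
  shows "A *v x = 0"
proof -
  have "psd_sqrt A *v x = 0"
    using assms psd_sqrt_vector_norm[OF assms(1), of x] by simp
  then show ?thesis
    using psd_sqrt(2)[OF assms(1)] by (metis matrix_vector_mul_assoc matrix_vector_mult_0_right)
qed

text \<open>With \<open>C = psd_sqrt B ** psd_sqrt A\<close> the left-hand matrix is \<open>C\<^sup>* C\<close>, so both sides amount to \<open>C = 0\<close>.\<close>

lemma psd_sqrt_mult_eq_zero_iff:
  fixes A B :: "complex ^ 'n ^ 'n"
  assumes "pos_semidef A" "pos_semidef B"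
  shows "psd_sqrt A ** B ** psd_sqrt A = 0 \<longleftrightarrow> A ** B = 0"
proof -
  define P Q where "P = psd_sqrt A" and "Q = psd_sqrt B"
  have P: "pos_semidef P" "P ** P = A" "adjoint_matrix P = P"
    and Q: "pos_semidef Q" "Q ** Q = B" "adjoint_matrix Q = Q"
    using psd_sqrt[OF assms(1)] psd_sqrt[OF assms(2)]
    by (auto simp: P_def Q_def intro: pos_semidef_hermitian)
  have *: "Q ** P = 0 \<longleftrightarrow> P ** Q = 0"
    using P(3) Q(3) adjoint_matrix_mult[of Q P] adjoint_matrix_mult[of P Q]
    by (metis adjoint_matrix_zero)
  have "adjoint_matrix (Q ** P) ** (Q ** P) = P ** (Q ** Q) ** P"
    by (simp only: adjoint_matrix_mult P(3) Q(3) matrix_mul_assoc)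
  then have gram: "adjoint_matrix (Q ** P) ** (Q ** P) = P ** B ** P"
    by (simp only: Q(2))
  have 1: "P ** B ** P = 0 \<longleftrightarrow> Q ** P = 0"
    using gram gram_eq_zero[of "Q ** P"] by (metis matrix_mult_zero(2))
  have 2: "P ** B ** P = 0" if "A ** B = 0"
  proof -
    have "adjoint_matrix (P ** B) ** (P ** B) = B ** (P ** P ** B)"
      by (simp only: adjoint_matrix_mult P(3) pos_semidef_hermitian[OF assms(2)] matrix_mul_assoc)
    then have "P ** B = 0"
      using gram_eq_zero[of "P ** B"] by (simp only: P(2) that matrix_mult_zero)
    then show ?thesis
      by (simp only: matrix_mult_zero)
  qed
  have 3: "A ** B = 0" if "Q ** P = 0"
  proof -
    have "A ** B = P ** (P ** Q) ** Q"
      by (simp only: P(2)[symmetric] Q(2)[symmetric] matrix_mul_assoc)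
    then show ?thesis
      using that * by (simp only: matrix_mult_zero)
  qed
  show ?thesis
    unfolding P_def[symmetric] using 1 2 3 by blast
qed

lemma closed_pos_semidef: "closed {A :: complex ^ 'n ^ 'n. pos_semidef A}"
proof -
  have "{A :: complex ^ 'n ^ 'n. pos_semidef A} =
    {A. adjoint_matrix A = A} \<inter> (\<Inter>x. {A. 0 \<le> Re (cinner x (A *v x))})"
    by (auto simp: pos_semidef_def)
  moreover have "closed {A :: complex ^ 'n ^ 'n. adjoint_matrix A = A}"
    unfolding adjoint_matrix_def by (intro closed_Collect_eq continuous_intros)
  moreover have "closed {A :: complex ^ 'n ^ 'n. 0 \<le> Re (cinner x (A *v x))}" for x
    by (intro closed_Collect_le continuous_intros)
  ultimately show ?thesis
    by (auto intro!: closed_Int closed_INT)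
qed

lemma continuous_on_matrix_mult [continuous_intros]:
  fixes f g :: "'a::topological_space \<Rightarrow> complex ^ 'n ^ 'n"
  shows "continuous_on S f \<Longrightarrow> continuous_on S g \<Longrightarrow> continuous_on S (\<lambda>x. f x ** g x)"
  unfolding matrix_matrix_mult_def by (intro continuous_intros)

lemma continuous_on_trace [continuous_intros]:
  fixes f :: "'a::topological_space \<Rightarrow> complex ^ 'n ^ 'n"
  shows "continuous_on S f \<Longrightarrow> continuous_on S (\<lambda>x. trace (f x))"
  unfolding trace_def by (intro continuous_intros)

lemma continuous_on_adjoint_matrix [continuous_intros]:
  fixes f :: "'a::topological_space \<Rightarrow> complex ^ 'n ^ 'n"
  shows "continuous_on S f \<Longrightarrow> continuous_on S (\<lambda>x. adjoint_matrix (f x))"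
  unfolding adjoint_matrix_def by (intro continuous_intros)

text \<open>The square root inverts the continuous map \<open>B \<mapsto> B\<^sup>2\<close>, and on a set of bounded trace
  the inverse image is compact because the trace of \<open>B\<^sup>2\<close> is the squared norm of \<open>B\<close>.\<close>

lemma continuous_on_psd_sqrt_bounded:
  "continuous_on {A :: complex ^ 'n ^ 'n. pos_semidef A \<and> Re (trace A) \<le> C} psd_sqrt"
proof -
  let ?K = "{B :: complex ^ 'n ^ 'n. pos_semidef B} \<inter> {B. Re (trace (B ** B)) \<le> C}"
  have "norm B \<le> sqrt \<bar>C\<bar>" if "B \<in> ?K" for B :: "complex ^ 'n ^ 'n"
  proof -
    have "(norm B)\<^sup>2 = Re (trace (B ** B))"
      using norm_matrix_trace[of B] that by (simp add: pos_semidef_hermitian)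
    then have "(norm B)\<^sup>2 \<le> \<bar>C\<bar>"
      using that by auto
    then show ?thesis
      by (rule real_le_rsqrt)
  qed
  then have "bounded ?K"
    unfolding bounded_iff by blast
  moreover have "closed ?K"
    by (intro closed_Int closed_pos_semidef closed_Collect_le continuous_intros)
  ultimately have "compact ?K"
    by (simp add: compact_eq_bounded_closed)
  then have "continuous_on ((\<lambda>B. B ** B) ` ?K) psd_sqrt"
    by (intro continuous_on_inv ballI) (auto intro!: continuous_intros psd_sqrt_of_square)
  moreover have "{A :: complex ^ 'n ^ 'n. pos_semidef A \<and> Re (trace A) \<le> C} \<subseteq> (\<lambda>B. B ** B) ` ?K"
  proof
    fix A :: "complex ^ 'n ^ 'n"
    assume "A \<in> {A. pos_semidef A \<and> Re (trace A) \<le> C}"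
    then show "A \<in> (\<lambda>B. B ** B) ` ?K"
      using psd_sqrt[of A] by (intro image_eqI[of _ _ "psd_sqrt A"]) auto
  qed
  ultimately show ?thesis
    by (rule continuous_on_subset)
qed

text \<open>On a compact domain the trace is bounded.\<close>

lemma continuous_on_psd_sqrt:
  fixes f :: "'a::topological_space \<Rightarrow> complex ^ 'n ^ 'n"
  assumes f: "continuous_on S f" and "compact S" and "\<And>x. x \<in> S \<Longrightarrow> pos_semidef (f x)"
  shows "continuous_on S (\<lambda>x. psd_sqrt (f x))"
proof -
  have "compact ((\<lambda>x. Re (trace (f x))) ` S)"
    by (intro compact_continuous_image continuous_intros f \<open>compact S\<close>)
  then obtain C where "\<And>x. x \<in> S \<Longrightarrow> Re (trace (f x)) \<le> C"
    using compact_imp_bounded bounded_iff by (metis abs_le_D1 imageI real_norm_def)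
  then show ?thesis
    using assms(3)
    by (intro continuous_on_compose2[OF continuous_on_psd_sqrt_bounded[of C] f]) auto
qed

lemma states_pos_semidef: "\<rho> \<in> states \<Longrightarrow> pos_semidef \<rho>"
  by (simp add: states_def)

lemma states_hermitian: "\<rho> \<in> states \<Longrightarrow> adjoint_matrix \<rho> = \<rho>"
  by (simp add: states_def pos_semidef_def)

lemma states_diagonalise:
  assumes "\<rho> \<in> states"
  obtains b \<mu> where "orthonormal b" "\<rho> = diag_in b \<mu>" "\<And>i. 0 \<le> \<mu> i" "(\<Sum>i\<in>UNIV. \<mu> i) = 1"
proof -
  obtain b \<mu> where b: "orthonormal b" "\<rho> = diag_in b \<mu>" "\<And>i. 0 \<le> \<mu> i"
    using pos_semidef_diagonalise[OF states_pos_semidef[OF assms]] by blast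
  have "complex_of_real (\<Sum>i\<in>UNIV. \<mu> i) = 1"
    using assms b trace_diag_in by (metis (mono_tags, lifting) mem_Collect_eq states_def)
  then have "(\<Sum>i\<in>UNIV. \<mu> i) = 1"
    using of_real_eq_1_iff by blast
  then show thesis
    using b that by blast
qed

lemma states_form_nonneg: "\<rho> \<in> states \<Longrightarrow> 0 \<le> Re (cinner x (\<rho> *v x))"
  by (simp add: states_def pos_semidef_def)

lemma compact_states: "compact (states :: (complex ^ 'n ^ 'n) set)"
proof -
  have "norm \<rho> \<le> 1" if \<rho>: "\<rho> \<in> states" for \<rho> :: "complex ^ 'n ^ 'n"
  proof -
    obtain b \<mu> where b: "orthonormal b" "\<rho> = diag_in b \<mu>" "\<And>i. 0 \<le> \<mu> i"
      using pos_semidef_diagonalise[OF states_pos_semidef[OF \<rho>]] by blast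
    have "complex_of_real (\<Sum>i\<in>UNIV. \<mu> i) = 1"
      using \<rho> b trace_diag_in by (metis (mono_tags, lifting) mem_Collect_eq states_def)
    then have one: "(\<Sum>i\<in>UNIV. \<mu> i) = 1"
      using of_real_eq_1_iff by blast
    have "\<mu> i \<le> 1" for i
      using member_le_sum[of i UNIV \<mu>] b(3) one by simp
    then have "(\<Sum>i\<in>UNIV. \<mu> i * \<mu> i) \<le> (\<Sum>i\<in>UNIV. \<mu> i)"
      using b(3) by (intro sum_mono) (simp add: mult_left_le)
    moreover have "complex_of_real ((norm \<rho>)\<^sup>2) = of_real (\<Sum>i\<in>UNIV. \<mu> i * \<mu> i)"
      unfolding norm_matrix_trace[symmetric] states_hermitian[OF \<rho>]
      unfolding b(2) diag_in_mult[OF b(1)] trace_diag_in[OF b(1)] ..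
    then have "(norm \<rho>)\<^sup>2 = (\<Sum>i\<in>UNIV. \<mu> i * \<mu> i)"
      using of_real_eq_iff by blast
    ultimately show ?thesis
      using one abs_square_le_1[of "norm \<rho>"] by simp
  qed
  then have "bounded (states :: (complex ^ 'n ^ 'n) set)"
    unfolding bounded_iff by blast
  moreover have "closed ({\<rho> :: complex ^ 'n ^ 'n. pos_semidef \<rho>} \<inter> {\<rho>. trace \<rho> = 1})"
    by (intro closed_Int closed_pos_semidef closed_Collect_eq continuous_intros)
  then have "closed (states :: (complex ^ 'n ^ 'n) set)"
    by (simp add: states_def Collect_conj_eq)
  ultimately show ?thesis
    by (simp add: compact_eq_bounded_closed)
qed

section \<open>Wigner's theorem\<close>

definition vcnj :: "complex ^ 'n \<Rightarrow> complex ^ 'n"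
  where "vcnj x = (\<chi> i. cnj (x $ i))"

lemma vcnj_involution: "vcnj (vcnj x) = x"
  by (simp add: vcnj_def vec_eq_iff)

lemma vcnj_add: "vcnj (x + y) = vcnj x + vcnj y"
  by (simp add: vcnj_def vec_eq_iff)

lemma vcnj_scale: "vcnj (c *s x) = cnj c *s vcnj x"
  by (simp add: vcnj_def vec_eq_iff)

lemma cinner_vcnj: "cinner (vcnj x) (vcnj y) = cnj (cinner x y)"
  by (simp add: vcnj_def cinner_def)

lemma Re_eq_of_cmod_eq:
  assumes "cmod h = cmod z" "cmod (1 + h) = cmod (1 + z)"
  shows "Re h = Re z"
proof -
  have "(cmod h)\<^sup>2 = (cmod z)\<^sup>2" "(cmod (1 + h))\<^sup>2 = (cmod (1 + z))\<^sup>2"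
    using assms by simp_all
  then show ?thesis
    unfolding cmod_power2 by (simp add: power2_eq_square algebra_simps)
qed

text \<open>The vectors with \<open>k\<close>-th coordinate one control all others: \<open>x\<close> with \<open>x $ k \<noteq> 0\<close> can
  be rescaled into this slice, and for \<open>x $ k = 0\<close> the vector \<open>axis k 1 + x\<close> of the slice has the same
  inner product with \<open>G x\<close> as \<open>x\<close>, up to modulus.\<close>

lemma phase_multiple_from_slice:
  fixes G :: "complex ^ 'n \<Rightarrow> complex ^ 'n"
  assumes pres: "\<And>x y. cmod (cinner (G x) (G y)) = cmod (cinner x y)"
    and comp: "\<And>x. cmod (G x $ k) = cmod (x $ k)"
    and slice: "\<And>x. x $ k = 1 \<Longrightarrow> \<exists>c. cmod c = 1 \<and> G x = c *s x"
  shows "\<exists>c. cmod c = 1 \<and> G x = c *s x"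
proof (rule cinner_max_imp_phase)
  have "complex_of_real ((norm (G x))\<^sup>2) = cinner (G x) (G x)"
    "complex_of_real ((norm x)\<^sup>2) = cinner x x"
    by (simp_all add: cinner_self)
  then have "(norm (G x))\<^sup>2 = (norm x)\<^sup>2"
    using pres[of x x] by (metis abs_of_nonneg norm_of_real zero_le_power2)
  then show "norm (G x) = norm x"
    by simp
  have on_slice: "cmod (cinner (G x) y) = cmod (cinner x y)" if "y $ k = 1" for y
  proof -
    obtain c where "cmod c = 1" "G y = c *s y"
      using slice \<open>y $ k = 1\<close> by blast
    then show ?thesis
      using pres[of x y] by (simp add: cinner_simps norm_mult)
  qed
  have "cmod (cinner (G x) x) = cmod (cinner x x)"
  proof (cases "x $ k = 0")
    case True
    have "G x $ k = 0"
      using comp[of x] True by simp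
    then have "cinner (G x) (axis k 1) = 0" "cinner x (axis k 1) = 0"
      using cinner_axis_left cinner_commute True by (metis complex_cnj_zero)+
    then show ?thesis
      using on_slice[of "axis k 1 + x"] True by (simp add: cinner_simps axis_def)
  next
    case False
    have "cmod (cinner (G x) ((1 / x $ k) *s x)) = cmod (cinner x ((1 / x $ k) *s x))"
      by (rule on_slice) (simp add: False)
    then show ?thesis
      using False by (simp add: cinner_simps norm_divide)
  qed
  then show "cmod (cinner (G x) x) = (norm x)\<^sup>2"
    by (simp add: cinner_self norm_power)
qed

text \<open>After normalising \<open>G\<close> on the basis vectors and on the sums \<open>axis k 1 + axis j 1\<close>, and after
  fixing the phase of \<open>G x\<close> by its \<open>k\<close>-th coordinate, the remaining coordinates of \<open>G x\<close> have the same modulus and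
  real part as those of \<open>x\<close>, so each is either the coordinate of \<open>x\<close> or its conjugate. Testing
  against \<open>axis k 1 + \<i> axis j 1\<close> shows that the choice depends on \<open>j\<close> alone, and testing against two such
  coordinates at once shows that it is the same for all \<open>j\<close>.\<close>

lemma wigner_normalised:
  fixes G :: "complex ^ 'n \<Rightarrow> complex ^ 'n"
  assumes pres: "\<And>x y. cmod (cinner (G x) (G y)) = cmod (cinner x y)"
    and comp: "\<And>x j. cmod (G x $ j) = cmod (x $ j)"
    and pair: "\<And>x j. j \<noteq> k \<Longrightarrow> cmod (G x $ k + G x $ j) = cmod (x $ k + x $ j)"
  shows "(\<forall>x. \<exists>c. cmod c = 1 \<and> G x = c *s x) \<or> (\<forall>x. \<exists>c. cmod c = 1 \<and> G x = c *s vcnj x)"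
proof -
  define H where "H x = cnj (G x $ k) *s G x" for x
  define e where "e j = axis k 1 + \<i> *s axis j (1::complex)" for j :: 'n
  have e_comp: "e j $ k = 1" "e j $ j = \<i>" "\<And>l. l \<noteq> j \<Longrightarrow> l \<noteq> k \<Longrightarrow> e j $ l = 0" if "j \<noteq> k" for j
    using that by (auto simp: e_def axis_def)
  have phase: "cmod (G x $ k) = 1" if "x $ k = 1" for x
    using comp[of x k] that by simp
  have Hk: "H x $ k = 1" if "x $ k = 1" for x
    using phase[OF that] by (simp add: H_def mult_cnj_cmod)
  have Hmod: "cmod (H x $ j) = cmod (x $ j)" if "x $ k = 1" for x j
    using phase[OF that] comp[of x j] by (simp add: H_def norm_mult)
  have Hpres: "cmod (cinner (H x) (H y)) = cmod (cinner x y)" if "x $ k = 1" "y $ k = 1" for x y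
    using phase[of x] phase[of y] that by (simp add: H_def cinner_simps norm_mult pres)
  have HRe: "Re (H x $ j) = Re (x $ j)" if "x $ k = 1" "j \<noteq> k" for x j
  proof (rule Re_eq_of_cmod_eq[OF Hmod[OF that(1)]])
    have "1 + H x $ j = cnj (G x $ k) * (G x $ k + G x $ j)"
      using Hk[OF that(1)] by (simp add: H_def algebra_simps)
    then show "cmod (1 + H x $ j) = cmod (1 + x $ j)"
      using pair[OF that(2), of x] phase[OF that(1)] that(1) by (simp add: norm_mult)
  qed
  define t where "t j = H (e j) $ j" for j
  have t_cases: "t j = \<i> \<or> t j = - \<i>" if "j \<noteq> k" for j
  proof -
    have "Re (t j) = 0" "cmod (t j) = 1"
      using HRe[of "e j" j] Hmod[of "e j" j] e_comp[OF that] that by (simp_all add: t_def)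
    then have "(Im (t j))\<^sup>2 = 1"
      using cmod_power2[of "t j"] by simp
    then have "Im (t j) = 1 \<or> Im (t j) = - 1"
      by (simp add: power2_eq_1_iff)
    then show ?thesis
      using \<open>Re (t j) = 0\<close> by (auto simp: complex_eq_iff)
  qed
  have He: "H (e j) = axis k 1 + t j *s axis j 1" if "j \<noteq> k" for j
  proof -
    have "H (e j) $ l = (axis k 1 + t j *s axis j 1) $ l" for l
      using that Hk[of "e j"] Hmod[of "e j" l] e_comp[OF that] by (auto simp: t_def axis_def)
    then show ?thesis
      by (simp add: vec_eq_iff)
  qed
  have HIm: "Re (cnj (t j) * H x $ j) = Im (x $ j)" if "x $ k = 1" "j \<noteq> k" for x j
  proof -
    have "cmod (1 + cnj (t j) * H x $ j) = cmod (1 + (- \<i>) * x $ j)"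
      using Hpres[of "e j" x] e_comp(1)[OF that(2)] that(1) Hk[OF that(1)]
      unfolding He[OF that(2)] by (simp add: e_def cinner_simps cinner_axis_left)
    moreover have "cmod (cnj (t j) * H x $ j) = cmod ((- \<i>) * x $ j)"
      using t_cases[OF that(2)] Hmod[OF that(1), of j] by (auto simp: norm_mult)
    ultimately have "Re (cnj (t j) * H x $ j) = Re ((- \<i>) * x $ j)"
      by (intro Re_eq_of_cmod_eq)
    then show ?thesis
      by simp
  qed
  have plus: "H x $ j = x $ j" if "x $ k = 1" "j \<noteq> k" "t j = \<i>" for x j
    using HRe[OF that(1,2)] HIm[OF that(1,2)] that(3) by (simp add: complex_eq_iff)
  have minus: "H x $ j = cnj (x $ j)" if "x $ k = 1" "j \<noteq> k" "t j = - \<i>" for x j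
    using HRe[OF that(1,2)] HIm[OF that(1,2)] that(3) by (simp add: complex_eq_iff)
  have same: "t l = \<i>" if "j \<noteq> k" "l \<noteq> k" "t j = \<i>" for j l
  proof (rule ccontr)
    assume "t l \<noteq> \<i>"
    then have l: "t l = - \<i>"
      using t_cases[OF that(2)] by blast
    then have "j \<noteq> l"
      using that(3) by (auto simp: complex_eq_iff)
    define x :: "complex ^ 'n" where "x = axis k 1 + axis j 1 + axis l 1"
    define y :: "complex ^ 'n" where "y = axis k 1 + \<i> *s axis j 1 + \<i> *s axis l 1"
    have k1: "x $ k = 1" "y $ k = 1"
      using that by (simp_all add: x_def y_def axis_def)
    have "H x $ i = x $ i" for i
      using Hk[OF k1(1)] plus[OF k1(1) that(1,3)] minus[OF k1(1) that(2) l] Hmod[OF k1(1), of i]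
        that \<open>j \<noteq> l\<close>
      by (cases "i = k \<or> i = j \<or> i = l") (auto simp: x_def axis_def)
    then have Hx: "H x = x"
      by (simp add: vec_eq_iff)
    have "H y $ i = (axis k 1 + \<i> *s axis j 1 - \<i> *s axis l 1) $ i" for i
      using Hk[OF k1(2)] plus[OF k1(2) that(1,3)] minus[OF k1(2) that(2) l] Hmod[OF k1(2), of i]
        that \<open>j \<noteq> l\<close>
      by (cases "i = k \<or> i = j \<or> i = l") (auto simp: y_def axis_def)
    then have Hy: "H y = axis k 1 + \<i> *s axis j 1 - \<i> *s axis l 1"
      by (simp add: vec_eq_iff)
    have "cinner (H x) (H y) = 1" "cinner x y = 1 + 2 * \<i>"
      using that \<open>j \<noteq> l\<close> unfolding Hx Hy
      by (simp_all add: x_def y_def cinner_simps cinner_axis_left) (simp_all add: axis_def)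
    then have "cmod (1 + 2 * \<i>) = 1"
      using Hpres[OF k1] by simp
    then show False
      by (simp add: cmod_def)
  qed
  have G_H: "G x = (G x $ k) *s H x" if "x $ k = 1" for x
    using phase[OF that] by (simp add: H_def vec_eq_iff mult.assoc[symmetric] mult_cnj_cmod)
  consider "\<And>j. j \<noteq> k \<Longrightarrow> t j = \<i>" | "\<And>j. j \<noteq> k \<Longrightarrow> t j = - \<i>"
    using same t_cases by blast
  then show ?thesis
  proof cases
    case 1
    have "\<exists>c. cmod c = 1 \<and> G x = c *s x" if "x $ k = 1" for x
    proof -
      have "H x $ j = x $ j" for j
        using plus[OF that _ 1] Hk[OF that] that by (cases "j = k") auto
      then have "H x = x"
        by (simp add: vec_eq_iff)
      then show ?thesis
        using G_H[OF that] phase[OF that] by metis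
    qed
    then show ?thesis
      using phase_multiple_from_slice[of G k] pres comp by blast
  next
    case 2
    let ?G = "\<lambda>x. vcnj (G x)"
    have "\<exists>c. cmod c = 1 \<and> ?G x = c *s x" if "x $ k = 1" for x
    proof -
      have "H x $ j = vcnj x $ j" for j
        using minus[OF that _ 2] Hk[OF that] that by (cases "j = k") (auto simp: vcnj_def)
      then have "H x = vcnj x"
        by (simp add: vec_eq_iff)
      then have "?G x = cnj (G x $ k) *s x"
        using G_H[OF that] by (metis vcnj_scale vcnj_involution)
      then show ?thesis
        using phase[OF that] by (metis complex_mod_cnj)
    qed
    then have *: "\<exists>c. cmod c = 1 \<and> ?G x = c *s x" for x
      using phase_multiple_from_slice[of ?G k] pres comp
      by (simp add: cinner_vcnj) (simp add: vcnj_def)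
    have "\<exists>c. cmod c = 1 \<and> G x = c *s vcnj x" for x
    proof -
      obtain c where "cmod c = 1" "?G x = c *s x"
        using * by blast
      then have "cmod (cnj c) = 1" "G x = cnj c *s vcnj x"
        by (simp, metis vcnj_scale vcnj_involution)
      then show ?thesis
        by blast
    qed
    then show ?thesis
      by blast
  qed
qed

lemma orthonormal_columns_isometry:
  fixes b :: "'n \<Rightarrow> complex ^ 'n"
  assumes "orthonormal b"
  defines "V \<equiv> (\<chi> i j. b j $ i)"
  shows "cinner (V *v x) (V *v y) = cinner x y" "V *v (adjoint_matrix V *v x) = x"
proof -
  show "cinner (V *v x) (V *v y) = cinner x y"
    using orthonormal_columns(1)[OF assms(1)]
    by (simp add: cinner_matrix_right matrix_vector_mul_assoc V_def)
  show "V *v (adjoint_matrix V *v x) = x"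
    using orthonormal_columns(2)[OF assms(1)] by (simp add: matrix_vector_mul_assoc V_def)
qed

lemma unitary_columns:
  fixes b :: "'n \<Rightarrow> complex ^ 'n"
  assumes "orthonormal b"
  shows "unitary ((*v) (\<chi> i j. b j $ i))"
  unfolding unitary_def
  using orthonormal_columns_isometry[OF assms] by (auto intro!: surjI)

lemma antiunitary_columns:
  fixes b :: "'n \<Rightarrow> complex ^ 'n"
  assumes "orthonormal b"
  shows "antiunitary (\<lambda>x. (\<chi> i j. b j $ i) *v vcnj x)"
  unfolding antiunitary_def conj_linear_def
proof (intro conjI allI)
  let ?V = "\<chi> i j. b j $ i"
  show "surj (\<lambda>x. ?V *v vcnj x)"
    by (rule surjI[of _ "\<lambda>x. vcnj (adjoint_matrix ?V *v x)"])
      (simp add: vcnj_involution orthonormal_columns_isometry[OF assms])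
qed (simp_all add: vcnj_add vcnj_scale cinner_vcnj matrix_vector_right_distrib
    matrix_vector_scale orthonormal_columns_isometry[OF assms])

text \<open>The images of the standard basis vectors are orthonormal; with suitable phases they form a basis \<open>b\<close> in which
  \<open>F\<close> has normalised coordinates.\<close>

theorem wigner:
  fixes F :: "complex ^ 'n \<Rightarrow> complex ^ 'n"
  assumes pres: "\<And>x y. cmod (cinner (F x) (F y)) = cmod (cinner x y)"
  shows "\<exists>U. (unitary U \<or> antiunitary U) \<and> (\<forall>x. \<exists>c. cmod c = 1 \<and> F x = c *s U x)"
proof -
  obtain k :: 'n where True
    by blast
  define a where "a j = F (axis j 1)" for j
  define w where "w j = F (axis k 1 + axis j 1)" for j
  have F_self: "cinner (F x) (F x) = cinner x x" for x
    using pres[of x x] by (simp add: cinner_self norm_power)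
  have a: "orthonormal a"
    unfolding orthonormal_def
  proof (intro allI)
    fix i j
    show "cinner (a i) (a j) = (if i = j then 1 else 0)"
      using pres[of "axis i 1" "axis j 1"] F_self[of "axis i 1"]
      by (auto simp: a_def cinner_axis_left) (auto simp: axis_def)
  qed
  have a_mod: "cmod (cinner (a j) (F x)) = cmod (x $ j)" for j x
    using pres[of "axis j 1" x] by (simp add: a_def cinner_axis_left)
  \<comment> \<open>The phases \<open>c j\<close> are chosen so that \<open>F\<close> maps \<open>axis k 1 + axis j 1\<close> to a multiple of \<open>b k + b j\<close>.\<close>
  define c where "c j = (if j = k then 1 else cinner (a j) (w j) / cinner (a k) (w j))" for j
  define b where "b j = c j *s a j" for j
  have w_mod: "cmod (cinner (a k) (w j)) = 1" "cmod (cinner (a j) (w j)) = 1" if "j \<noteq> k" for j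
    using that by (simp_all add: w_def a_mod axis_def)
  have c_mod: "cmod (c j) = 1" for j
    by (simp add: c_def norm_divide w_mod)
  then have "c j * cnj (c j) = 1" for j
    by (simp add: mult_cnj_cmod)
  then have b: "orthonormal b"
    using a by (simp add: orthonormal_def b_def cinner_simps)
  have w: "w j = cinner (a k) (w j) *s (b k + b j)" if "j \<noteq> k" for j
  proof -
    have "cinner (a i) (w j) = 0" if "i \<noteq> k" "i \<noteq> j" for i
      using a_mod[of i "axis k 1 + axis j 1"] that by (simp add: w_def axis_def)
    then have "w j = (\<Sum>i\<in>{k, j}. cinner (a i) (w j) *s a i)"
      by (subst orthonormal_expand[OF a, of "w j"]) (intro sum.mono_neutral_right, auto)
    then have "w j = cinner (a k) (w j) *s a k + cinner (a j) (w j) *s a j"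
      using \<open>j \<noteq> k\<close> by auto
    moreover have "cinner (a k) (w j) * c j = cinner (a j) (w j)"
      using \<open>j \<noteq> k\<close> w_mod[OF \<open>j \<noteq> k\<close>] by (auto simp: c_def)
    ultimately show ?thesis
      by (simp add: b_def vector_add_ldistrib) (simp add: c_def)
  qed
  define V where "V = (\<chi> i j. b j $ i)"
  define G where "G x = adjoint_matrix V *v F x" for x
  have G_nth: "G x $ j = cinner (b j) (F x)" for x j
    by (simp add: G_def V_def adjoint_matrix_def matrix_vector_mult_def cinner_def)
  have F: "F x = V *v G x" for x
    using orthonormal_columns_isometry(2)[OF b] by (simp add: V_def G_def)
  have "cmod (cinner (G x) (G y)) = cmod (cinner x y)" for x y
    using pres[of x y] orthonormal_columns_isometry(1)[OF b]
    by (simp add: F[of x] F[of y] V_def)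
  moreover have "cmod (G x $ j) = cmod (x $ j)" for x j
    by (simp add: G_nth b_def cinner_simps norm_mult c_mod a_mod)
  moreover have "cmod (G x $ k + G x $ j) = cmod (x $ k + x $ j)" if "j \<noteq> k" for x j
  proof -
    have "cmod (x $ k + x $ j) = cmod (cinner (w j) (F x))"
      by (simp add: w_def pres cinner_simps cinner_axis_left)
    also have "\<dots> = cmod (cinner (b k + b j) (F x))"
      by (subst w[OF that])
        (simp only: cinner_scale_left norm_mult complex_mod_cnj w_mod(1)[OF that] mult_1)
    finally show ?thesis
      by (simp add: G_nth cinner_simps)
  qed
  ultimately have "(\<forall>x. \<exists>c. cmod c = 1 \<and> G x = c *s x) \<or>
      (\<forall>x. \<exists>c. cmod c = 1 \<and> G x = c *s vcnj x)"
    by (rule wigner_normalised)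
  then show ?thesis
  proof
    assume *: "\<forall>x. \<exists>c. cmod c = 1 \<and> G x = c *s x"
    have "\<exists>c. cmod c = 1 \<and> F x = c *s (V *v x)" for x
      using *[rule_format, of x] by (auto simp: F matrix_vector_scale)
    then show ?thesis
      using unitary_columns[OF b] unfolding V_def by blast
  next
    assume *: "\<forall>x. \<exists>c. cmod c = 1 \<and> G x = c *s vcnj x"
    have "\<exists>c. cmod c = 1 \<and> F x = c *s (V *v vcnj x)" for x
      using *[rule_format, of x] by (auto simp: F matrix_vector_scale)
    then show ?thesis
      using antiunitary_columns[OF b] unfolding V_def by blast
  qed
qed

section \<open>Unitary and antiunitary conjugation\<close>

text \<open>The two kinds of symmetry differ only in the automorphism \<open>\<kappa>\<close> of the scalars. Eigenvalues of states are
  real, hence fixed by \<open>\<kappa>\<close>, and so both kinds transport spectral decompositions alike.\<close>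

lemma symmetry_cases:
  assumes "unitary U \<or> antiunitary U"
  obtains \<kappa> where "\<kappa> = id \<or> \<kappa> = cnj" "\<And>x y. U (x + y) = U x + U y"
    "\<And>c x. U (c *s x) = \<kappa> c *s U x" "\<And>x y. cinner (U x) (U y) = \<kappa> (cinner x y)" "surj U"
  using assms
proof
  assume "unitary U"
  then show thesis
    by (intro that[of id]) (auto simp: unitary_def Vector_Spaces.linear_iff)
next
  assume "antiunitary U"
  then show thesis
    by (intro that[of cnj]) (auto simp: antiunitary_def conj_linear_def)
qed

lemma symmetry_orthonormal:
  assumes "unitary U \<or> antiunitary U" "orthonormal b"
  shows "orthonormal (U \<circ> b)"
proof -
  obtain \<kappa> where "\<kappa> = id \<or> \<kappa> = cnj" "\<And>x y. cinner (U x) (U y) = \<kappa> (cinner x y)"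
    using symmetry_cases[OF assms(1)] by metis
  then show ?thesis
    using assms(2) by (auto simp: orthonormal_def)
qed

lemma symmetry_norm:
  assumes "unitary U \<or> antiunitary U"
  shows "norm (U x) = norm x"
proof -
  obtain \<kappa> where "\<kappa> = id \<or> \<kappa> = cnj" "\<And>x y. cinner (U x) (U y) = \<kappa> (cinner x y)"
    using symmetry_cases[OF assms] by metis
  then have "complex_of_real ((norm (U x))\<^sup>2) = of_real ((norm x)\<^sup>2)"
    by (metis cinner_self complex_cnj_complex_of_real id_apply)
  then have "(norm (U x))\<^sup>2 = (norm x)\<^sup>2"
    using of_real_eq_iff by blast
  then show ?thesis
    by simp
qed

lemma symmetry_diag_in:
  assumes "unitary U \<or> antiunitary U"
  shows "U (diag_in b \<mu> *v y) = diag_in (U \<circ> b) \<mu> *v U y"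
proof -
  obtain \<kappa> where \<kappa>: "\<kappa> = id \<or> \<kappa> = cnj" and add: "\<And>x y. U (x + y) = U x + U y"
    and scale: "\<And>c x. U (c *s x) = \<kappa> c *s U x"
    and inner: "\<And>x y. cinner (U x) (U y) = \<kappa> (cinner x y)"
    using symmetry_cases[OF assms] by metis
  have "U 0 = 0"
    using add[of 0 0] by simp
  then have sum: "U (sum f I) = (\<Sum>i\<in>I. U (f i))" for f :: "'i \<Rightarrow> _" and I
    by (induction I rule: infinite_finite_induct) (simp_all add: add)
  show ?thesis
    using \<kappa> by (auto simp: diag_in_def matrix_sum_vector matrix_scaleR_vector proj_vector
        sum scale inner)
qed

lemma conjugate_by_diag_in:
  assumes "unitary U \<or> antiunitary U"
  shows "conjugate_by U (diag_in b \<mu>) = diag_in (U \<circ> b) \<mu>"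
proof -
  have "surj U"
    using assms by (auto simp: unitary_def antiunitary_def)
  then have "U (diag_in b \<mu> *v inv U x) = diag_in (U \<circ> b) \<mu> *v x" for x
    by (simp add: symmetry_diag_in[OF assms] surj_f_inv_f)
  then show ?thesis
    by (simp add: conjugate_by_def)
qed

section \<open>The trace metric\<close>

lemma trace_norm_diag_in:
  assumes "orthonormal b"
  shows "trace_norm (diag_in b \<mu>) = (\<Sum>i\<in>UNIV. \<bar>\<mu> i\<bar>)"
proof -
  have "abs_matrix (diag_in b \<mu>) = diag_in b (\<lambda>i. \<bar>\<mu> i\<bar>)"
    unfolding abs_matrix_def
    by (rule psd_sqrt_eqI)
      (simp_all add: pos_semidef_diag_in adjoint_matrix_diag_in diag_in_mult assms abs_mult[symmetric])
  then show ?thesis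
    by (simp add: trace_norm_def trace_diag_in[OF assms] flip: of_real_sum)
qed

lemma trace_dist_self: "trace_dist \<rho> \<rho> = 0"
  by (simp add: trace_dist_def trace_norm_def abs_matrix_def matrix_mult_zero psd_sqrt_zero trace_zero)

lemma continuous_on_trace_dist:
  "continuous_on (states \<times> states) (\<lambda>(\<rho>, \<sigma>). trace_dist \<rho> (\<sigma> :: complex ^ 'n ^ 'n))"
  unfolding trace_dist_def trace_norm_def abs_matrix_def case_prod_unfold
  by (intro continuous_intros continuous_on_psd_sqrt pos_semidef_gram compact_Times compact_states)

text \<open>In an eigenbasis of \<open>\<rho> - \<sigma>\<close>, the bound \<open>\<bar>r - s\<bar> \<le> r + s\<close> for the diagonal entries
  must be an equality at each place when the distance is \<open>2\<close>, so each basis vector is annihilated by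
  \<open>\<rho>\<close> or by \<open>\<sigma>\<close>. Conversely, \<open>\<bar>\<rho> - \<sigma>\<bar> = \<rho> + \<sigma>\<close> for orthogonal states.\<close>

lemma trace_dist_eq_2_iff:
  fixes \<rho> \<sigma> :: "complex ^ 'n ^ 'n"
  assumes "\<rho> \<in> states" "\<sigma> \<in> states"
  shows "trace_dist \<rho> \<sigma> = 2 \<longleftrightarrow> \<rho> ** \<sigma> = 0"
proof
  note herm = states_hermitian[OF assms(1)] states_hermitian[OF assms(2)]
  assume 2: "trace_dist \<rho> \<sigma> = 2"
  obtain b \<mu> where b: "orthonormal b" "\<rho> - \<sigma> = diag_in b \<mu>"
    using spectral_theorem[of "\<rho> - \<sigma>"] herm by (auto simp: adjoint_matrix_diff)
  define r s where "r i = Re (cinner (b i) (\<rho> *v b i))" and "s i = Re (cinner (b i) (\<sigma> *v b i))" for i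
  have nonneg: "0 \<le> r i" "0 \<le> s i" for i
    using assms by (simp_all add: r_def s_def states_form_nonneg)
  have "trace \<rho> = (\<Sum>i\<in>UNIV. cinner (b i) (\<rho> *v b i))"
    "trace \<sigma> = (\<Sum>i\<in>UNIV. cinner (b i) (\<sigma> *v b i))"
    by (intro trace_orthonormal b(1))+
  then have sums: "(\<Sum>i\<in>UNIV. r i) = 1" "(\<Sum>i\<in>UNIV. s i) = 1"
    using assms by (simp_all add: states_def r_def s_def flip: Re_sum)
  have diff: "\<rho> *v b i - \<sigma> *v b i = complex_of_real (\<mu> i) *s b i" for i
    using b by (metis diag_in_basis matrix_vector_mult_diff_rdistrib)
  have "\<mu> i = r i - s i" for i
  proof -
    have "r i - s i = Re (cinner (b i) (\<rho> *v b i - \<sigma> *v b i))"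
      by (simp add: r_def s_def cinner_simps)
    also have "\<dots> = \<mu> i"
      unfolding diff using b(1) by (simp add: cinner_simps orthonormal_def)
    finally show ?thesis ..
  qed
  then have "(\<Sum>i\<in>UNIV. \<bar>r i - s i\<bar>) = 2"
    using 2 by (simp add: trace_dist_def b(2) trace_norm_diag_in[OF b(1)])
  then have "(\<Sum>i\<in>UNIV. r i + s i - \<bar>r i - s i\<bar>) = 0"
    using sums by (simp add: sum_subtractf sum.distrib)
  then have "r i + s i - \<bar>r i - s i\<bar> = 0" for i
    using nonneg by (subst (asm) sum_nonneg_eq_0_iff) (auto simp: abs_if)
  then have "r i = 0 \<or> s i = 0" for i
    by (smt (verit, best))
  then have zero: "\<rho> *v b i = 0 \<or> \<sigma> *v b i = 0" for i
    using pos_semidef_form_zero assms states_pos_semidef unfolding r_def s_def by blast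
  have "(\<rho> ** \<sigma>) *v b i = 0 *v b i" for i
  proof (cases "\<sigma> *v b i = 0")
    case True
    then show ?thesis
      by (simp add: matrix_vector_mul_assoc[symmetric])
  next
    case False
    then have \<rho>: "\<rho> *v b i = 0"
      using zero by blast
    then have "\<sigma> *v b i = complex_of_real (- \<mu> i) *s b i"
      using diff[of i] by (simp add: vec_eq_iff) (metis minus_minus)
    then show ?thesis
      by (simp only: matrix_vector_mul_assoc[symmetric] matrix_vector_scale \<rho>) simp
  qed
  then show "\<rho> ** \<sigma> = 0"
    using orthonormal_eqI[OF b(1)] by blast
next
  assume 0: "\<rho> ** \<sigma> = 0"
  note herm = states_hermitian[OF assms(1)] states_hermitian[OF assms(2)]
  have comm: "\<sigma> ** \<rho> = 0"
    using adjoint_matrix_mult[of \<rho> \<sigma>] by (simp only: herm 0 adjoint_matrix_zero)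
  have "abs_matrix (\<rho> - \<sigma>) = \<rho> + \<sigma>"
    unfolding abs_matrix_def
  proof (rule psd_sqrt_eqI)
    show "pos_semidef (\<rho> + \<sigma>)"
      using assms by (simp add: states_def pos_semidef_def adjoint_matrix_add
          matrix_vector_mult_add_rdistrib cinner_simps)
    show "(\<rho> + \<sigma>) ** (\<rho> + \<sigma>) = adjoint_matrix (\<rho> - \<sigma>) ** (\<rho> - \<sigma>)"
      by (simp add: adjoint_matrix_diff herm matrix_add_ldistrib matrix_add_mult_left
          matrix_diff_mult_left matrix_diff_mult_right 0 comm)
  qed
  then show "trace_dist \<rho> \<sigma> = 2"
    using assms by (simp add: trace_dist_def trace_norm_def trace_add states_def)
qed

lemma trace_mult_proj: "trace (A ** proj x) = cinner x (A *v x)"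
  by (simp add: trace_def matrix_matrix_mult_def proj_def cinner_def matrix_vector_mult_def
      sum_distrib_left mult_ac)

text \<open>Put \<open>X = proj x - proj y\<close>. On the span of \<open>x\<close> and \<open>y\<close> the square \<open>X\<^sup>2\<close> is multiplication by
  \<open>1 - \<bar>\<langle>x, y\<rangle>\<bar>\<^sup>2\<close>, and it vanishes on the orthogonal complement, so \<open>\<bar>X\<bar>\<close> is a multiple of \<open>X\<^sup>2\<close>.\<close>

lemma trace_dist_proj_proj:
  fixes x y :: "complex ^ 'n"
  assumes "norm x = 1" "norm y = 1"
  shows "trace_dist (proj x) (proj y) = 2 * sqrt (1 - (cmod (cinner x y))\<^sup>2)"
proof -
  define c where "c = cinner x y"
  define t where "t = (cmod c)\<^sup>2"
  define X where "X = proj x - proj y"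
  have cc: "c * cnj c = complex_of_real t" "cnj c * c = complex_of_real t"
    by (simp_all add: t_def mult_cnj_cmod)
  have inner: "cinner x x = 1" "cinner y y = 1" "cinner x y = c" "cinner y x = cnj c"
    using assms cinner_commute[of y x] by (simp_all add: cinner_self c_def)
  have X: "X *v v = cinner x v *s x - cinner y v *s y" for v
    by (simp add: X_def matrix_vector_mult_diff_rdistrib proj_vector)
  have XX: "X *v (X *v x) = complex_of_real (1 - t) *s x" "X *v (X *v y) = complex_of_real (1 - t) *s y"
    unfolding X inner cinner_simps
    by (simp_all add: vec_eq_iff algebra_simps flip: cc)
  have XXX: "X *v (X *v (X *v v)) = complex_of_real (1 - t) *s (X *v v)" for v
    unfolding X[of v]
    by (simp add: matrix_vector_mult_diff_distrib matrix_vector_scale XX)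
      (simp add: vec_eq_iff algebra_simps)
  define D where "D = adjoint_matrix X ** X"
  have D: "D = X ** X"
    by (simp add: D_def X_def adjoint_matrix_diff adjoint_matrix_proj)
  have "D ** D = (1 - t) *\<^sub>R D"
    by (simp only: matrix_eq D matrix_vector_mul_assoc[symmetric] matrix_scaleR_vector XXX
        matrix_vector_scale simp_thms)
  have t1: "t \<le> 1"
  proof -
    have "0 \<le> (norm (X *v x))\<^sup>2"
      by simp
    also have "(norm (X *v x))\<^sup>2 = Re (cinner x (D *v x))"
      by (simp add: D_def matrix_vector_mul_assoc[symmetric] cinner_matrix_right
          adjoint_matrix_involution cinner_self)
    also have "\<dots> = 1 - t"
      by (simp add: D matrix_vector_mul_assoc[symmetric] XX cinner_simps inner)
    finally show ?thesis
      by simp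
  qed
  have "trace D = cinner x (X *v x) - cinner y (X *v y)"
    unfolding D by (subst (2) X_def) (simp add: matrix_diff_mult_right trace_sub trace_mult_proj)
  then have trD: "Re (trace D) = 2 * (1 - t)"
    by (simp add: X cinner_simps inner cc)
  \<comment> \<open>For \<open>t = 1\<close> this is \<open>0 = 0\<close>, with the convention \<open>1 / 0 = 0\<close>.\<close>
  have "psd_sqrt D = (1 / sqrt (1 - t)) *\<^sub>R D"
  proof (rule psd_sqrt_eqI)
    show "pos_semidef ((1 / sqrt (1 - t)) *\<^sub>R D)"
      using t1 by (simp add: D_def pos_semidef_scaleR pos_semidef_gram)
    have "t = 1 \<Longrightarrow> D = 0"
      using pos_semidef_trace_zero[of D] trD by (simp add: D_def pos_semidef_gram)
    then show "((1 / sqrt (1 - t)) *\<^sub>R D) ** ((1 / sqrt (1 - t)) *\<^sub>R D) = D"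
      using t1 \<open>D ** D = (1 - t) *\<^sub>R D\<close>
      by (cases "t = 1") (simp_all add: matrix_scaleR_mult_left matrix_scaleR_mult_right)
  qed
  then have "trace_dist (proj x) (proj y) = 2 * (1 - t) / sqrt (1 - t)"
    by (simp add: trace_dist_def trace_norm_def abs_matrix_def X_def[symmetric] D_def[symmetric]
        trace_scaleR trD)
  also have "\<dots> = 2 * sqrt (1 - t)"
    using t1 real_div_sqrt[of "1 - t"] by (metis diff_ge_0_iff_ge times_divide_eq_right)
  finally show ?thesis
    by (simp add: t_def c_def)
qed

lemma trace_dist_eigenprojection:
  fixes b :: "'n \<Rightarrow> complex ^ 'n"
  assumes "orthonormal b" "\<And>i. 0 \<le> \<mu> i" "(\<Sum>i\<in>UNIV. \<mu> i) = 1"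
  shows "trace_dist (diag_in b \<mu>) (proj (b k)) = 2 * (1 - \<mu> k)"
proof -
  let ?\<nu> = "\<lambda>i. \<mu> i - (if i = k then 1 else 0)"
  have "diag_in b \<mu> - proj (b k) = diag_in b ?\<nu>"
    using assms(1)
    by (intro diag_in_eqI)
      (auto simp: matrix_vector_mult_diff_rdistrib diag_in_basis proj_vector orthonormal_def vec_eq_iff
        algebra_simps)
  then have "trace_dist (diag_in b \<mu>) (proj (b k)) = (\<Sum>i\<in>UNIV. \<bar>?\<nu> i\<bar>)"
    by (simp add: trace_dist_def trace_norm_diag_in[OF assms(1)])
  also have "\<dots> = \<bar>\<mu> k - 1\<bar> + (\<Sum>i\<in>UNIV - {k}. \<bar>?\<nu> i\<bar>)"
    by (simp add: sum.remove[of UNIV k])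
  also have "(\<Sum>i\<in>UNIV - {k}. \<bar>?\<nu> i\<bar>) = (\<Sum>i\<in>UNIV - {k}. \<mu> i)"
    using assms(2) by (intro sum.cong) auto
  also have "\<dots> = 1 - \<mu> k"
    using assms(3) by (simp add: sum.remove[of UNIV k])
  also have "\<bar>\<mu> k - 1\<bar> = 1 - \<mu> k"
    using member_le_sum[of k UNIV \<mu>] assms by simp
  finally show ?thesis
    by simp
qed

text \<open>The operator \<open>X = \<sigma> - proj x\<close> has trace zero, so its trace norm is twice the sum of the negative
  parts of its eigenvalues, while \<open>\<langle>x, X x\<rangle>\<close> is an average of the eigenvalues. In the case of
  equality either \<open>X = 0\<close> or this average is the single negative eigenvalue, with eigenvector \<open>x\<close>.\<close>

lemma trace_dist_proj_bound:
  fixes \<sigma> :: "complex ^ 'n ^ 'n"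
  assumes "\<sigma> \<in> states" "norm x = 1"
  defines "s \<equiv> Re (cinner x (\<sigma> *v x))"
  shows "2 * (1 - s) \<le> trace_dist \<sigma> (proj x)"
    and "trace_dist \<sigma> (proj x) = 2 * (1 - s) \<Longrightarrow> \<sigma> *v x = complex_of_real s *s x"
proof -
  define X where "X = \<sigma> - proj x"
  have "adjoint_matrix X = X"
    by (simp add: X_def adjoint_matrix_diff adjoint_matrix_proj states_hermitian[OF assms(1)])
  then obtain b \<mu> where b: "orthonormal b" "X = diag_in b \<mu>"
    using spectral_theorem by blast
  define p where "p i = (cmod (cinner (b i) x))\<^sup>2" for i
  have p_sum: "(\<Sum>i\<in>UNIV. p i) = 1"
    using orthonormal_parseval[OF b(1), of x] assms(2) by (simp add: p_def)
  have p: "0 \<le> p i" "p i \<le> 1" for i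
    using member_le_sum[of i UNIV p] p_sum by (simp_all add: p_def)
  have "trace X = 0"
    using assms(1,2) by (simp add: X_def trace_sub trace_proj states_def)
  then have "complex_of_real (\<Sum>i\<in>UNIV. \<mu> i) = 0"
    using trace_diag_in[OF b(1)] b(2) by metis
  then have \<mu>_sum: "(\<Sum>i\<in>UNIV. \<mu> i) = 0"
    using of_real_eq_0_iff by blast
  have "cinner x (X *v x) = cinner x (\<sigma> *v x) - 1"
    by (simp add: X_def matrix_vector_mult_diff_rdistrib proj_vector cinner_simps cinner_self assms(2))
  then have form: "(\<Sum>i\<in>UNIV. \<mu> i * p i) = s - 1"
    using diag_in_form[of x b \<mu>] b(2) by (simp add: s_def p_def complex_eq_iff del: of_real_sum)
  have dist: "trace_dist \<sigma> (proj x) = (\<Sum>i\<in>UNIV. \<bar>\<mu> i\<bar>)"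
    using trace_norm_diag_in[OF b(1)] b(2) by (simp add: trace_dist_def X_def)
  have gap: "trace_dist \<sigma> (proj x) - 2 * (1 - s) = (\<Sum>i\<in>UNIV. \<bar>\<mu> i\<bar> - \<mu> i + 2 * (\<mu> i * p i))"
    using \<mu>_sum form dist by (simp add: sum.distrib sum_subtractf flip: sum_distrib_left)
  have term_nonneg: "0 \<le> \<bar>\<mu> i\<bar> - \<mu> i + 2 * (\<mu> i * p i)" for i
  proof (cases "0 \<le> \<mu> i")
    case True
    then show ?thesis
      using p(1)[of i] by simp
  next
    case False
    then have "\<mu> i * 1 \<le> \<mu> i * p i"
      using p(2)[of i] by (intro mult_left_mono_neg) auto
    then show ?thesis
      using False by simp
  qed
  show "2 * (1 - s) \<le> trace_dist \<sigma> (proj x)"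
    using gap sum_nonneg[of UNIV "\<lambda>i. \<bar>\<mu> i\<bar> - \<mu> i + 2 * (\<mu> i * p i)"] term_nonneg by simp
  assume "trace_dist \<sigma> (proj x) = 2 * (1 - s)"
  then have "\<bar>\<mu> i\<bar> - \<mu> i + 2 * (\<mu> i * p i) = 0" for i
    using gap term_nonneg by (simp add: sum_nonneg_eq_0_iff)
  then have eq: "\<mu> i < 0 \<Longrightarrow> p i = 1" for i
    by (smt (verit, best) mult_cancel_left1)
  have "\<exists>m. X *v x = complex_of_real m *s x"
  proof (cases "\<exists>k. \<mu> k < 0")
    case True
    then obtain k where k: "p k = 1"
      using eq by blast
    have "(\<Sum>i\<in>UNIV - {k}. p i) = 0"
      using p_sum k by (simp add: sum.remove[of UNIV k])
    then have "cinner (b i) x = 0" if "i \<noteq> k" for i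
      using that by (simp add: sum_nonneg_eq_0_iff p_def)
    then have "x = (\<Sum>i\<in>{k}. cinner (b i) x *s b i)"
      by (subst orthonormal_expand[OF b(1), of x]) (intro sum.mono_neutral_right, auto)
    then have "x = cinner (b k) x *s b k"
      by simp
    then have "X *v x = complex_of_real (\<mu> k) *s x"
      by (metis b diag_in_basis matrix_vector_scale vector_smult_assoc mult.commute)
    then show ?thesis
      by blast
  next
    case False
    then have "\<mu> i = 0" for i
      using \<mu>_sum by (simp add: sum_nonneg_eq_0_iff not_less)
    then show ?thesis
      by (intro exI[of _ 0]) (simp add: b(2) diag_in_def)
  qed
  then obtain m where "X *v x = complex_of_real m *s x"
    by blast
  then have "\<sigma> *v x = complex_of_real (1 + m) *s x"
    by (simp add: X_def matrix_vector_mult_diff_rdistrib proj_vector cinner_self assms(2) vec_eq_iff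
        algebra_simps)
  moreover from this have "s = 1 + m"
    by (simp add: s_def cinner_simps cinner_self assms(2))
  ultimately show "\<sigma> *v x = complex_of_real s *s x"
    by simp
qed

text \<open>The distances to the eigenprojections of \<open>\<rho>\<close> suffice: they bound the diagonal of \<open>\<sigma>\<close> in the transported
  basis from below by the eigenvalues of \<open>\<rho>\<close>, and since both add up to one, every bound is an
  equality.\<close>

lemma trace_dist_determines:
  fixes U :: "complex ^ 'n \<Rightarrow> complex ^ 'n"
  assumes U: "unitary U \<or> antiunitary U" and "\<rho> \<in> states" "\<sigma> \<in> states"
    and dist: "\<And>x. norm x = 1 \<Longrightarrow> trace_dist \<sigma> (proj (U x)) = trace_dist \<rho> (proj x)"
  shows "\<sigma> = conjugate_by U \<rho>"
proof -
  obtain b \<mu> where b: "orthonormal b" "\<rho> = diag_in b \<mu>"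
    and \<mu>: "\<And>i. 0 \<le> \<mu> i" "(\<Sum>i\<in>UNIV. \<mu> i) = 1"
    using states_diagonalise[OF assms(2)] by blast
  let ?f = "U \<circ> b"
  have f: "orthonormal ?f"
    by (rule symmetry_orthonormal[OF U b(1)])
  define s where "s i = Re (cinner (?f i) (\<sigma> *v ?f i))" for i
  have dist': "trace_dist \<sigma> (proj (?f i)) = 2 * (1 - \<mu> i)" for i
    using dist[OF orthonormal_norm[OF b(1)]] trace_dist_eigenprojection[OF b(1) \<mu>]
    by (simp add: b(2))
  note bound = trace_dist_proj_bound[OF assms(3) orthonormal_norm[OF f], folded s_def]
  have "\<mu> i \<le> s i" for i
    using bound(1)[of i] dist'[of i] by simp
  moreover have "(\<Sum>i\<in>UNIV. s i) = 1"
    using trace_orthonormal[OF f, of \<sigma>] assms(3) by (simp add: s_def states_def flip: Re_sum)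
  ultimately have "s i = \<mu> i" for i
    using \<mu>(2) sum_mono_inv[of \<mu> UNIV s i] by simp
  then have "\<sigma> *v ?f i = complex_of_real (\<mu> i) *s ?f i" for i
    using bound(2)[of i] dist'[of i] by simp
  then show ?thesis
    unfolding b(2) conjugate_by_diag_in[OF U] by (rule diag_in_eqI[OF f])
qed

section \<open>The Bures metric\<close>

lemma bures_dist_states:
  assumes "\<rho> \<in> states" "\<sigma> \<in> states"
  shows "bures_dist \<rho> \<sigma> = sqrt (2 - 2 * Re (trace (psd_sqrt (psd_sqrt \<rho> ** \<sigma> ** psd_sqrt \<rho>))))"
  using assms by (simp add: bures_dist_def states_def)

lemma bures_dist_self: "\<rho> \<in> states \<Longrightarrow> bures_dist \<rho> \<rho> = 0"
proof -
  assume \<rho>: "\<rho> \<in> states"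
  note sq = psd_sqrt(2)[OF states_pos_semidef[OF \<rho>]]
  have "psd_sqrt \<rho> ** \<rho> ** psd_sqrt \<rho> = (psd_sqrt \<rho> ** psd_sqrt \<rho>) ** (psd_sqrt \<rho> ** psd_sqrt \<rho>)"
    by (subst (2) sq[symmetric]) (simp only: matrix_mul_assoc)
  also have "\<dots> = \<rho> ** \<rho>"
    by (simp only: sq)
  finally show ?thesis
    using \<rho> by (simp add: bures_dist_states psd_sqrt_of_square states_pos_semidef)
      (simp add: states_def)
qed

lemma continuous_on_bures_dist:
  "continuous_on (states \<times> states) (\<lambda>(\<rho>, \<sigma>). bures_dist \<rho> (\<sigma> :: complex ^ 'n ^ 'n))"
  unfolding bures_dist_def case_prod_unfold
  by (intro continuous_intros continuous_on_psd_sqrt compact_Times compact_states)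
    (simp_all add: mem_Times_iff pos_semidef_sandwich psd_sqrt states_pos_semidef)

lemma bures_dist_eq_sqrt2_iff:
  fixes \<rho> \<sigma> :: "complex ^ 'n ^ 'n"
  assumes "\<rho> \<in> states" "\<sigma> \<in> states"
  shows "bures_dist \<rho> \<sigma> = sqrt 2 \<longleftrightarrow> \<rho> ** \<sigma> = 0"
proof -
  let ?M = "psd_sqrt \<rho> ** \<sigma> ** psd_sqrt \<rho>"
  note psd = states_pos_semidef[OF assms(1)] states_pos_semidef[OF assms(2)]
  have M: "pos_semidef ?M"
    using psd psd_sqrt(1) pos_semidef_sandwich by blast
  have "bures_dist \<rho> \<sigma> = sqrt 2 \<longleftrightarrow> Re (trace (psd_sqrt ?M)) = 0"
    by (simp add: bures_dist_states assms)
  also have "\<dots> \<longleftrightarrow> psd_sqrt ?M = 0"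
    using pos_semidef_trace_zero[OF psd_sqrt(1)[OF M]] by (auto simp: trace_zero)
  also have "\<dots> \<longleftrightarrow> ?M = 0"
    using psd_sqrt(2)[OF M] by (metis matrix_mult_zero(1) psd_sqrt_zero)
  also have "\<dots> \<longleftrightarrow> \<rho> ** \<sigma> = 0"
    by (rule psd_sqrt_mult_eq_zero_iff[OF psd])
  finally show ?thesis .
qed

lemma psd_sqrt_proj: "psd_sqrt (proj y) = (1 / norm y) *\<^sub>R proj y"
proof (rule psd_sqrt_eqI)
  show "pos_semidef ((1 / norm y) *\<^sub>R proj y)"
    by (simp add: pos_semidef_scaleR pos_semidef_proj)
  have "proj y ** proj y = (norm y)\<^sup>2 *\<^sub>R proj y"
    by (simp add: matrix_eq matrix_vector_mul_assoc[symmetric] proj_vector matrix_scaleR_vector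
        cinner_simps cinner_self mult.commute)
  moreover have "y = 0 \<Longrightarrow> proj y = 0"
    by (simp add: proj_def vec_eq_iff)
  ultimately show "((1 / norm y) *\<^sub>R proj y) ** ((1 / norm y) *\<^sub>R proj y) = proj y"
    by (cases "y = 0")
      (simp_all add: matrix_scaleR_mult_left matrix_scaleR_mult_right power2_eq_square)
qed

text \<open>Against a pure state the fidelity matrix has rank one, and the distance depends only on \<open>\<langle>x, \<rho> x\<rangle>\<close>.\<close>

lemma bures_dist_proj:
  assumes "\<rho> \<in> states" "norm x = 1"
  shows "bures_dist \<rho> (proj x) = sqrt (2 - 2 * sqrt (Re (cinner x (\<rho> *v x))))"
proof -
  let ?y = "psd_sqrt \<rho> *v x"
  note psd = states_pos_semidef[OF assms(1)]
  have "psd_sqrt \<rho> ** proj x ** psd_sqrt \<rho> = proj ?y"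
    using matrix_proj_matrix[of "psd_sqrt \<rho>" x]
    by (simp add: pos_semidef_hermitian[OF psd_sqrt(1)[OF psd]])
  moreover have "Re (trace (psd_sqrt (proj ?y))) = norm ?y"
    by (cases "?y = 0") (simp_all add: psd_sqrt_proj trace_scaleR trace_proj trace_zero power2_eq_square)
  ultimately show ?thesis
    using assms by (simp add: bures_dist_states proj_in_states psd_sqrt_vector_norm[OF psd])
qed

lemma bures_dist_proj_proj:
  assumes "norm x = 1" "norm y = 1"
  shows "bures_dist (proj x) (proj y) = sqrt (2 - 2 * cmod (cinner x y))"
proof -
  have "Re (cinner y (proj x *v y)) = (cmod (cinner x y))\<^sup>2"
    using cinner_commute[of y x]
    by (simp add: proj_vector cinner_simps mult_cnj_cmod flip: of_real_power)
  then show ?thesis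
    using assms by (simp add: bures_dist_proj proj_in_states)
qed

lemma hermitian_eqI_form:
  fixes A B :: "complex ^ 'n ^ 'n"
  assumes "adjoint_matrix A = A" "adjoint_matrix B = B"
    and form: "\<And>x. norm x = 1 \<Longrightarrow> Re (cinner x (A *v x)) = Re (cinner x (B *v x))"
  shows "A = B"
proof -
  obtain b \<mu> where b: "orthonormal b" "A - B = diag_in b \<mu>"
    using spectral_theorem[of "A - B"] assms by (auto simp: adjoint_matrix_diff)
  have "\<mu> i = 0" for i
  proof -
    have "\<mu> i = Re (cinner (b i) ((A - B) *v b i))"
      using b(1) unfolding b(2) by (simp add: diag_in_basis cinner_simps) (simp add: orthonormal_def)
    also have "\<dots> = 0"
      using form[OF orthonormal_norm[OF b(1), of i]]
      by (simp add: matrix_vector_mult_diff_rdistrib cinner_simps)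
    finally show ?thesis .
  qed
  then have "A - B = 0"
    by (simp add: b(2) diag_in_def)
  then show ?thesis
    by simp
qed

text \<open>The distances to the pure states determine the values of the quadratic form on unit vectors.\<close>

lemma bures_dist_determines:
  fixes U :: "complex ^ 'n \<Rightarrow> complex ^ 'n"
  assumes U: "unitary U \<or> antiunitary U" and "\<rho> \<in> states" "\<sigma> \<in> states"
    and dist: "\<And>x. norm x = 1 \<Longrightarrow> bures_dist \<sigma> (proj (U x)) = bures_dist \<rho> (proj x)"
  shows "\<sigma> = conjugate_by U \<rho>"
proof (rule hermitian_eqI_form)
  obtain b \<mu> where b: "orthonormal b" "\<rho> = diag_in b \<mu>"
    using states_diagonalise[OF assms(2)] by blast
  show "adjoint_matrix \<sigma> = \<sigma>"
    by (rule states_hermitian[OF assms(3)])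
  show "adjoint_matrix (conjugate_by U \<rho>) = conjugate_by U \<rho>"
    by (simp add: b(2) conjugate_by_diag_in[OF U] adjoint_matrix_diag_in)
  obtain \<kappa> where \<kappa>: "\<kappa> = id \<or> \<kappa> = cnj" "\<And>x y. cinner (U x) (U y) = \<kappa> (cinner x y)" "surj U"
    using symmetry_cases[OF U] by metis
  fix z :: "complex ^ 'n"
  assume z: "norm z = 1"
  obtain x where x: "z = U x"
    using \<kappa>(3) by (metis surjD)
  then have x1: "norm x = 1"
    using z symmetry_norm[OF U] by simp
  have "Re (cinner z (\<sigma> *v z)) = Re (cinner x (\<rho> *v x))"
    using dist[OF x1] bures_dist_proj[OF assms(3) z] bures_dist_proj[OF assms(2) x1]
    by (simp add: x)
  also have "\<dots> = Re (cinner z (conjugate_by U \<rho> *v z))"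
    unfolding b(2) conjugate_by_diag_in[OF U] diag_in_form using \<kappa> by (auto simp: x)
  finally show "Re (cinner z (\<sigma> *v z)) = Re (cinner z (conjugate_by U \<rho> *v z))" .
qed

section \<open>Isometries of the state space\<close>

text \<open>Up to a phase, \<open>x\<close> is a member of every eigenbasis of \<open>proj x\<close>.\<close>

lemma unit_vector_extends_to_basis:
  fixes x :: "complex ^ 'n"
  assumes "norm x = 1"
  obtains b :: "'n \<Rightarrow> complex ^ 'n" and k where "orthonormal b" "proj (b k) = proj x"
proof -
  obtain b \<mu> where b: "orthonormal b" "proj x = diag_in b \<mu>" and "(\<Sum>i\<in>UNIV. \<mu> i) = 1"
    using states_diagonalise[OF proj_in_states[OF assms]] by blast
  then obtain k where k: "\<mu> k \<noteq> 0"
    by (metis sum.neutral zero_neq_one)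
  define c where "c = cinner x (b k) / complex_of_real (\<mu> k)"
  have "cinner x (b k) *s x = complex_of_real (\<mu> k) *s b k"
    using b diag_in_basis proj_vector by metis
  then have "b k = c *s x"
    using k by (simp add: c_def vec_eq_iff field_simps)
  moreover from this have "cmod c = 1"
    using orthonormal_norm[OF b(1), of k] assms by (simp add: norm_scale)
  ultimately have "proj (b k) = proj x"
    by (simp add: proj_phase)
  then show thesis
    using that b(1) by blast
qed

lemma diag_in_indicator: "diag_in b (\<lambda>j. if j = i then r else 0) = r *\<^sub>R proj (b i)"
proof -
  have "diag_in b (\<lambda>j. if j = i then r else 0) = (\<Sum>j\<in>UNIV. if j = i then r *\<^sub>R proj (b i) else 0)"
    unfolding diag_in_def by (rule sum.cong) auto
  then show ?thesis
    by simp
qed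

text \<open>A family of mutually orthogonal states that is as long as the dimension consists of pure
  states: unit vectors in the ranges form an orthonormal basis, and every state of the family
  annihilates all vectors of this basis but its own.\<close>

lemma orthogonal_states_pure:
  fixes R :: "'n \<Rightarrow> complex ^ 'n ^ 'n"
  assumes states: "\<And>i. R i \<in> states" and orth: "\<And>i j. i \<noteq> j \<Longrightarrow> R i ** R j = 0"
  shows "\<exists>v. orthonormal v \<and> (\<forall>i. R i = proj (v i))"
proof -
  note herm = states_hermitian[OF states]
  have "\<exists>u. norm (R i *v u) = 1" for i
  proof -
    have "R i \<noteq> 0"
      using states[of i] by (auto simp: states_def trace_zero)
    then obtain z where z: "R i *v z \<noteq> 0"
      by (metis matrix_eq matrix_vector_mult_0)
    then have "norm (R i *v (complex_of_real (1 / norm (R i *v z)) *s z)) = 1"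
      by (simp add: matrix_vector_scale norm_scale norm_divide)
    then show ?thesis
      by blast
  qed
  then obtain u where u: "\<And>i. norm (R i *v u i) = 1"
    by metis
  define v where "v i = R i *v u i" for i
  have Rv: "R i *v v j = 0" if "i \<noteq> j" for i j
    using orth[OF that] by (simp add: v_def matrix_vector_mul_assoc)
  have "cinner (v i) (v j) = 0" if "i \<noteq> j" for i j
    unfolding v_def[of i] using Rv[OF that] by (simp add: hermitian_cinner[OF herm] cinner_simps)
  moreover have "cinner (v i) (v i) = 1" for i
    using u by (simp add: cinner_self v_def)
  ultimately have v: "orthonormal v"
    by (auto simp: orthonormal_def)
  have "R i = proj (v i)" for i
  proof -
    define r where "r = Re (cinner (v i) (R i *v v i))"
    have "cinner (v j) (R i *v v i) = 0" if "j \<noteq> i" for j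
      using Rv[of i j] that by (simp add: hermitian_cinner[OF herm, symmetric] cinner_simps)
    then have "R i *v v i = (\<Sum>j\<in>{i}. cinner (v j) (R i *v v i) *s v j)"
      by (subst orthonormal_expand[OF v, of "R i *v v i"]) (intro sum.mono_neutral_right, auto)
    then have "R i *v v i = complex_of_real r *s v i"
      using hermitian_form_real[OF herm, of "v i" i] by (simp add: r_def)
    then have "R i = diag_in v (\<lambda>j. if j = i then r else 0)"
      using Rv by (intro diag_in_eqI[OF v]) auto
    then have R: "R i = r *\<^sub>R proj (v i)"
      by (simp add: diag_in_indicator)
    then have "complex_of_real r = 1"
      using states[of i] orthonormal_norm[OF v, of i] by (simp add: states_def trace_scaleR trace_proj)
    then show ?thesis
      using R by simp
  qed
  then show ?thesis
    using v by blast
qed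

text \<open>What the trace metric and the Bures metric have in common: maximal distance means
  orthogonality, the distance of pure states determines their transition probability, and a state is
  determined by its distances to the pure states. The last property is stated relative to a unitary or
  antiunitary \<open>U\<close> because an isometry will first be known on the pure states only, where it acts
  as \<open>U\<close>.\<close>

locale pure_state_metric =
  fixes \<delta> :: "complex ^ 'n ^ 'n \<Rightarrow> complex ^ 'n ^ 'n \<Rightarrow> real" and m :: real
  assumes self: "\<rho> \<in> states \<Longrightarrow> \<delta> \<rho> \<rho> = 0"
    and continuous: "continuous_on (states \<times> states) (\<lambda>(\<rho>, \<sigma>). \<delta> \<rho> \<sigma>)"
    and maximal: "\<rho> \<in> states \<Longrightarrow> \<sigma> \<in> states \<Longrightarrow> \<delta> \<rho> \<sigma> = m \<longleftrightarrow> \<rho> ** \<sigma> = 0"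
    and transition: "norm x = 1 \<Longrightarrow> norm y = 1 \<Longrightarrow> norm x' = 1 \<Longrightarrow> norm y' = 1 \<Longrightarrow>
      \<delta> (proj x) (proj y) = \<delta> (proj x') (proj y') \<Longrightarrow> cmod (cinner x y) = cmod (cinner x' y')"
    and determines: "unitary U \<or> antiunitary U \<Longrightarrow> \<rho> \<in> states \<Longrightarrow> \<sigma> \<in> states \<Longrightarrow>
      (\<And>x. norm x = 1 \<Longrightarrow> \<delta> \<sigma> (proj (U x)) = \<delta> \<rho> (proj x)) \<Longrightarrow> \<sigma> = conjugate_by U \<rho>"
begin

text \<open>Complete \<open>x\<close> to an orthonormal basis. The images of its projections have maximal mutual distances, so they are
  mutually orthogonal, and there are as many of them as the dimension.\<close>

lemma isometry_preserves_pure: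
  assumes T: "\<And>\<rho>. \<rho> \<in> states \<Longrightarrow> T \<rho> \<in> states"
    and iso: "\<And>\<rho> \<sigma>. \<rho> \<in> states \<Longrightarrow> \<sigma> \<in> states \<Longrightarrow> \<delta> (T \<rho>) (T \<sigma>) = \<delta> \<rho> \<sigma>"
    and "norm x = 1"
  shows "\<exists>y. norm y = 1 \<and> T (proj x) = proj y"
proof -
  obtain b and k :: 'n where b: "orthonormal b" "proj (b k) = proj x"
    using unit_vector_extends_to_basis[OF assms(3)] by blast
  have pure: "proj (b i) \<in> states" for i
    by (intro proj_in_states orthonormal_norm b(1))
  have "proj (b i) ** proj (b j) = 0" if "i \<noteq> j" for i j
    using b(1) that by (simp add: matrix_eq matrix_vector_mul_assoc[symmetric] proj_vector cinner_simps)
      (simp add: orthonormal_def)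
  then have orth: "T (proj (b i)) ** T (proj (b j)) = 0" if "i \<noteq> j" for i j
    using that maximal[OF pure pure, of i j] maximal[OF T[OF pure] T[OF pure], of i j] iso[OF pure pure, of i j]
    by simp
  obtain v where v: "orthonormal v" "\<And>i. T (proj (b i)) = proj (v i)"
    using orthogonal_states_pure[of "\<lambda>i. T (proj (b i))", OF T[OF pure] orth] by blast
  have "T (proj x) = proj (v k)"
    using v(2)[of k] b(2) by simp
  then show ?thesis
    using orthonormal_norm[OF v(1)] by blast
qed

text \<open>On pure states \<open>T\<close> preserves transition probabilities, so Wigner's theorem provides \<open>U\<close>; the other states
  are determined by their distances to pure states. The second part of the conclusion applies to \<open>\<sigma> = T \<rho>\<close>, but also to any other state in the same
  position relative to the range of \<open>T\<close>; limits of almost isometric images are of this kind.\<close>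

theorem isometry_rigid:
  assumes T: "\<And>\<rho>. \<rho> \<in> states \<Longrightarrow> T \<rho> \<in> states"
    and iso: "\<And>\<rho> \<sigma>. \<rho> \<in> states \<Longrightarrow> \<sigma> \<in> states \<Longrightarrow> \<delta> (T \<rho>) (T \<sigma>) = \<delta> \<rho> \<sigma>"
  obtains U where "unitary U \<or> antiunitary U"
    "\<And>\<rho> \<sigma>. \<rho> \<in> states \<Longrightarrow> \<sigma> \<in> states \<Longrightarrow> (\<And>\<tau>. \<tau> \<in> states \<Longrightarrow> \<delta> \<sigma> (T \<tau>) = \<delta> \<rho> \<tau>) \<Longrightarrow>
      \<sigma> = conjugate_by U \<rho>"
proof -
  have "\<forall>x. \<exists>y. norm x = 1 \<longrightarrow> norm y = 1 \<and> T (proj x) = proj y"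
    using isometry_preserves_pure[OF assms] by blast
  from choice[OF this] obtain f where f: "\<And>x. norm x = 1 \<Longrightarrow> norm (f x) = 1"
    "\<And>x. norm x = 1 \<Longrightarrow> T (proj x) = proj (f x)"
    by blast
  have f_inner: "cmod (cinner (f x) (f y)) = cmod (cinner x y)" if "norm x = 1" "norm y = 1" for x y
    using transition[OF f(1) f(1), of x y x y] iso[OF proj_in_states proj_in_states, of x y] f(2) that
    by simp
  \<comment> \<open>Homogeneous extension of \<open>f\<close> from unit vectors to all vectors.\<close>
  define unit where "unit x = complex_of_real (1 / norm x) *s x" for x :: "complex ^ 'n"
  define F where "F x = complex_of_real (norm x) *s f (unit x)" for x
  have unit: "norm (unit x) = 1" "x = complex_of_real (norm x) *s unit x" if "x \<noteq> 0" for x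
    using that by (simp_all add: unit_def norm_scale norm_divide)
  have "cmod (cinner (F x) (F y)) = cmod (cinner x y)" for x y
  proof (cases "x = 0 \<or> y = 0")
    case True
    then show ?thesis
      by (auto simp: F_def cinner_simps)
  next
    case False
    then have "cmod (cinner (F x) (F y)) = norm x * norm y * cmod (cinner (unit x) (unit y))"
      by (simp add: F_def cinner_simps norm_mult f_inner unit)
    also have "\<dots> = cmod (cinner (complex_of_real (norm x) *s unit x) (complex_of_real (norm y) *s unit y))"
      by (simp add: cinner_simps norm_mult)
    also have "\<dots> = cmod (cinner x y)"
      using False unit(2) by metis
    finally show ?thesis .
  qed
  from wigner[of F, OF this] obtain U where U: "unitary U \<or> antiunitary U"
    and phase: "\<And>x. \<exists>c. cmod c = 1 \<and> F x = c *s U x"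
    by blast
  have pure: "T (proj x) = proj (U x)" if "norm x = 1" for x
  proof -
    have "F x = f x"
      using that by (simp add: F_def unit_def)
    then show ?thesis
      using phase[of x] f(2)[OF that] proj_phase by metis
  qed
  show thesis
  proof (rule that[OF U])
    fix \<rho> \<sigma> :: "complex ^ 'n ^ 'n"
    assume *: "\<rho> \<in> states" "\<sigma> \<in> states" "\<And>\<tau>. \<tau> \<in> states \<Longrightarrow> \<delta> \<sigma> (T \<tau>) = \<delta> \<rho> \<tau>"
    show "\<sigma> = conjugate_by U \<rho>"
    proof (rule determines[OF U *(1,2)])
      fix x :: "complex ^ 'n"
      assume "norm x = 1"
      then show "\<delta> \<sigma> (proj (U x)) = \<delta> \<rho> (proj x)"
        using *(3)[OF proj_in_states] pure by metis
    qed
  qed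
qed

section \<open>Stability by compactness\<close>

lemma tendsto_metric:
  assumes "(f \<longlongrightarrow> \<rho>) G" "(g \<longlongrightarrow> \<sigma>) G" "\<rho> \<in> states" "\<sigma> \<in> states"
    and "\<And>n. f n \<in> states" "\<And>n. g n \<in> states"
  shows "((\<lambda>n. \<delta> (f n) (g n)) \<longlongrightarrow> \<delta> \<rho> \<sigma>) G"
proof -
  have "((\<lambda>n. (f n, g n)) \<longlongrightarrow> (\<rho>, \<sigma>)) G"
    by (intro tendsto_Pair assms)
  from continuous_on_tendsto_compose[OF continuous this] show ?thesis
    using assms(3-6) by simp
qed

end

text \<open>Subsequences do not suffice for pointwise convergence on the uncountable state space; filters below the given
  one take their place.\<close>

lemma compact_limit_along_filter:
  assumes "compact K" "F \<noteq> bot" "\<And>n. f n \<in> K"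
  shows "\<exists>G\<le>F. G \<noteq> bot \<and> (\<exists>l\<in>K. (f \<longlongrightarrow> l) G)"
proof -
  have "filtermap f F \<noteq> bot" "eventually (\<lambda>y. y \<in> K) (filtermap f F)"
    using assms(2,3) by (simp_all add: filtermap_bot_iff eventually_filtermap)
  then obtain l where l: "l \<in> K" "inf (nhds l) (filtermap f F) \<noteq> bot"
    using assms(1) unfolding compact_filter by blast
  define G where "G = inf F (filtercomap f (nhds l))"
  have "G \<noteq> bot"
  proof
    assume "G = bot"
    then have "eventually (\<lambda>_. False) G"
      by simp
    then obtain P Q where P: "eventually P F" and Q: "eventually Q (filtercomap f (nhds l))"
      and PQ: "\<And>n. P n \<and> Q n \<Longrightarrow> False"
      by (auto simp: G_def eventually_inf)
    from Q obtain R where R: "eventually R (nhds l)" "\<And>n. R (f n) \<Longrightarrow> Q n"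
      by (auto simp: eventually_filtercomap)
    have "eventually (\<lambda>y. \<not> R y) (filtermap f F)"
      unfolding eventually_filtermap using P by eventually_elim (use PQ R(2) in blast)
    then have "eventually (\<lambda>_. False) (inf (nhds l) (filtermap f F))"
      using R(1) unfolding eventually_inf by blast
    then show False
      using l(2) by (simp add: eventually_False)
  qed
  moreover have "(f \<longlongrightarrow> l) G"
    by (simp add: G_def filterlim_iff_le_filtercomap)
  moreover have "G \<le> F"
    by (simp add: G_def)
  ultimately show ?thesis
    using l(1) by blast
qed

lemma compact_functions_into:
  fixes K :: "'b::topological_space set"
  assumes "compact K"
  shows "compact {f :: 'a \<Rightarrow> 'b. \<forall>x. f x \<in> K}"
proof -
  have "compactin (product_topology (\<lambda>_. euclidean) UNIV) (PiE (UNIV :: 'a set) (\<lambda>_. K))"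
    using assms by (auto simp: compactin_PiE)
  moreover have "PiE (UNIV :: 'a set) (\<lambda>_. K) = {f. \<forall>x. f x \<in> K}"
    by auto
  ultimately show ?thesis
    by (simp add: euclidean_product_topology)
qed

lemma tendsto_apply:
  fixes f :: "'a \<Rightarrow> 'b \<Rightarrow> 'c::topological_space"
  assumes "(f \<longlongrightarrow> l) G"
  shows "((\<lambda>n. f n x) \<longlongrightarrow> l x) G"
  using continuous_on_tendsto_compose[OF continuous_on_product_coordinates assms, of x] by simp

context pure_state_metric
begin

text \<open>Otherwise maps \<open>T n\<close> that are isometric up to \<open>1 / (n + 1)\<close> would stay away from all
  conjugations. By Tychonoff's theorem they converge pointwise along some filter, necessarily to an isometry
  and hence to a conjugation \<open>L\<close>. Let \<open>r n\<close> be points where \<open>T n\<close> is far from \<open>L\<close>, and refine the filter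
  so that \<open>r n\<close>, \<open>T n (r n)\<close> and \<open>L (r n)\<close> converge. Both image sequences have limits that are in the same
  position relative to the range of \<open>L\<close>, so rigidity identifies them, a contradiction.\<close>

theorem near_isometry_stable:
  assumes "0 < \<eta>"
  shows "\<exists>\<epsilon>\<^sub>0>0. \<forall>\<epsilon>\<le>\<epsilon>\<^sub>0. \<forall>T. eps_isometry_on states \<delta> \<epsilon> T \<longrightarrow>
    (\<exists>U. (unitary U \<or> antiunitary U) \<and> (\<forall>\<rho>\<in>states. \<delta> (T \<rho>) (conjugate_by U \<rho>) \<le> \<eta>))"
proof (rule ccontr)
  assume neg: "\<not> ?thesis"
  have "\<exists>T. eps_isometry_on states \<delta> (1 / real (Suc n)) T \<and>
      (\<forall>U. unitary U \<or> antiunitary U \<longrightarrow> (\<exists>\<rho>\<in>states. \<eta> < \<delta> (T \<rho>) (conjugate_by U \<rho>)))" for n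
  proof -
    have "0 < 1 / real (Suc n)"
      by simp
    then obtain \<epsilon> T where "\<epsilon> \<le> 1 / real (Suc n)" "eps_isometry_on states \<delta> \<epsilon> T"
      "\<forall>U. unitary U \<or> antiunitary U \<longrightarrow> (\<exists>\<rho>\<in>states. \<eta> < \<delta> (T \<rho>) (conjugate_by U \<rho>))"
      using neg by (meson not_less)
    then show ?thesis
      unfolding eps_isometry_on_def by (meson order_trans)
  qed
  then obtain T0 where T0: "\<And>n. eps_isometry_on states \<delta> (1 / real (Suc n)) (T0 n)"
    and far: "\<And>n U. unitary U \<or> antiunitary U \<Longrightarrow>
      \<exists>\<rho>\<in>states. \<eta> < \<delta> (T0 n \<rho>) (conjugate_by U \<rho>)"
    by metis
  obtain \<rho>\<^sub>0 :: "complex ^ 'n ^ 'n" where \<rho>\<^sub>0: "\<rho>\<^sub>0 \<in> states"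
    using proj_in_states[of "axis undefined 1"] by (auto simp: norm_eq_1 inner_axis_axis)
  \<comment> \<open>Off the states, where nothing is known about \<open>T0 n\<close>, a default state keeps all values in a compact set.\<close>
  define T where "T n \<rho> = (if \<rho> \<in> states then T0 n \<rho> else \<rho>\<^sub>0)" for n \<rho>
  have T: "T n \<rho> \<in> states" for n \<rho>
    using T0[of n] \<rho>\<^sub>0 by (auto simp: T_def eps_isometry_on_def)
  have almost: "\<bar>\<delta> (T n \<rho>) (T n \<sigma>) - \<delta> \<rho> \<sigma>\<bar> \<le> 1 / real (Suc n)"
    if "\<rho> \<in> states" "\<sigma> \<in> states" for n \<rho> \<sigma>
    using T0[of n] that by (simp add: T_def eps_isometry_on_def)
  obtain G L where G: "G \<le> sequentially" "G \<noteq> bot" and L: "\<forall>\<rho>. L \<rho> \<in> states" "(T \<longlongrightarrow> L) G"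
    using compact_limit_along_filter[OF compact_functions_into[OF compact_states], of sequentially T] T
    by auto
  note T_lim = tendsto_apply[OF L(2)]
  have limit_eq: "a = d"
    if lim: "((\<lambda>n. s n) \<longlongrightarrow> a) G'" "((\<lambda>n. t n) \<longlongrightarrow> d) G'" and G': "G' \<le> sequentially" "G' \<noteq> bot"
      and close: "\<And>n. \<bar>s n - t n\<bar> \<le> 1 / real (Suc n)"
    for s t :: "nat \<Rightarrow> real" and a d G'
  proof -
    have "((\<lambda>n. 1 / real (Suc n)) \<longlongrightarrow> 0) G'"
      using tendsto_mono[OF G'(1) LIMSEQ_inverse_real_of_nat] by (simp add: inverse_eq_divide)
    then have "((\<lambda>n. s n - t n) \<longlongrightarrow> 0) G'"
      by (rule Lim_null_comparison[rotated]) (simp add: close del: of_nat_Suc)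
    then have "a - d = 0"
      using tendsto_unique[OF G'(2) tendsto_diff[OF lim]] by blast
    then show ?thesis
      by simp
  qed
  have L_iso: "\<delta> (L \<rho>) (L \<sigma>) = \<delta> \<rho> \<sigma>" if "\<rho> \<in> states" "\<sigma> \<in> states" for \<rho> \<sigma>
    by (rule limit_eq[OF tendsto_metric[OF T_lim T_lim] tendsto_const G])
      (use that L T almost in auto)
  obtain U where U: "unitary U \<or> antiunitary U"
    and rigid: "\<And>\<rho> \<sigma>. \<rho> \<in> states \<Longrightarrow> \<sigma> \<in> states \<Longrightarrow>
      (\<And>\<tau>. \<tau> \<in> states \<Longrightarrow> \<delta> \<sigma> (L \<tau>) = \<delta> \<rho> \<tau>) \<Longrightarrow> \<sigma> = conjugate_by U \<rho>"
    using isometry_rigid[of L] L(1) L_iso by blast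
  have L_U: "L \<rho> = conjugate_by U \<rho>" if "\<rho> \<in> states" for \<rho>
    using rigid[OF that] L(1) L_iso[OF that] by blast
  obtain r where r: "\<And>n. r n \<in> states" and "\<And>n. \<eta> < \<delta> (T0 n (r n)) (conjugate_by U (r n))"
    using far[OF U] by metis
  then have r_far: "\<eta> < \<delta> (T n (r n)) (L (r n))" for n
    by (simp add: T_def L_U)
  have "\<exists>G'\<le>G. G' \<noteq> bot \<and>
      (\<exists>l\<in>states \<times> states \<times> states. ((\<lambda>n. (r n, T n (r n), L (r n))) \<longlongrightarrow> l) G')"
    using r T L(1) G(2) by (intro compact_limit_along_filter compact_Times compact_states) auto
  then obtain G' l where G': "G' \<le> G" "G' \<noteq> bot" and l: "l \<in> states \<times> states \<times> states"
    and lim: "((\<lambda>n. (r n, T n (r n), L (r n))) \<longlongrightarrow> l) G'"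
    by blast
  obtain \<rho> \<sigma> \<sigma>' where l_eq: "l = (\<rho>, \<sigma>, \<sigma>')"
    by (metis prod.exhaust)
  have in_states: "\<rho> \<in> states" "\<sigma> \<in> states" "\<sigma>' \<in> states"
    using l by (simp_all add: l_eq)
  have lims: "(r \<longlongrightarrow> \<rho>) G'" "((\<lambda>n. T n (r n)) \<longlongrightarrow> \<sigma>) G'" "((\<lambda>n. L (r n)) \<longlongrightarrow> \<sigma>') G'"
    using tendsto_fst[OF lim] tendsto_fst[OF tendsto_snd[OF lim]] tendsto_snd[OF tendsto_snd[OF lim]]
    by (simp_all add: l_eq)
  have T_lim': "((\<lambda>n. T n \<tau>) \<longlongrightarrow> L \<tau>) G'" for \<tau>
    by (rule tendsto_mono[OF G'(1) T_lim])
  have G'_seq: "G' \<le> sequentially"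
    using G'(1) G(1) by (rule order_trans)
  have "\<delta> \<sigma> (L \<tau>) = \<delta> \<rho> \<tau>" if "\<tau> \<in> states" for \<tau>
    by (rule limit_eq[OF tendsto_metric[OF lims(2) T_lim'] tendsto_metric[OF lims(1) tendsto_const] G'_seq G'(2)])
      (use that L T almost r in_states in auto)
  then have "\<sigma> = conjugate_by U \<rho>"
    using rigid in_states by blast
  moreover have "\<delta> \<sigma>' (L \<tau>) = \<delta> \<rho> \<tau>" if "\<tau> \<in> states" for \<tau>
    by (rule limit_eq[OF tendsto_metric[OF lims(3) tendsto_const] tendsto_metric[OF lims(1) tendsto_const] G'_seq G'(2)])
      (use that L r in_states L_iso in auto)
  then have "\<sigma>' = conjugate_by U \<rho>"
    using rigid in_states by blast
  ultimately have "((\<lambda>n. \<delta> (T n (r n)) (L (r n))) \<longlongrightarrow> 0) G'"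
    using tendsto_metric[OF lims(2,3)] in_states T L(1) self by simp
  then have "\<eta> \<le> 0"
    using r_far by (intro tendsto_lowerbound[OF _ _ G'(2)]) (auto intro!: always_eventually less_imp_le)
  then show False
    using assms by simp
qed

lemma bounded_on_states: "\<exists>B\<ge>0. \<forall>\<rho>\<in>states. \<forall>\<sigma>\<in>states. \<delta> \<rho> \<sigma> \<le> B"
proof -
  have "compact ((\<lambda>(\<rho>, \<sigma>). \<delta> \<rho> \<sigma>) ` (states \<times> states))"
    by (intro compact_continuous_image continuous compact_Times compact_states)
  from compact_imp_bounded[OF this] obtain B where
    "\<forall>y\<in>(\<lambda>(\<rho>, \<sigma>). \<delta> \<rho> \<sigma>) ` (states \<times> states). norm y \<le> B"
    unfolding bounded_iff by blast
  then have "\<delta> \<rho> \<sigma> \<le> max B 0" if "\<rho> \<in> states" "\<sigma> \<in> states" for \<rho> \<sigma>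
    using that by (force simp: abs_le_iff)
  then show ?thesis
    by (intro exI[of _ "max B 0"]) simp
qed

theorem stability_modulus:
  "\<exists>\<omega> :: real \<Rightarrow> real. (\<forall>\<epsilon>\<ge>0. 0 \<le> \<omega> \<epsilon>) \<and> (\<omega> \<longlongrightarrow> 0) (at_right 0) \<and>
    (\<forall>\<epsilon>\<ge>0. \<forall>T. eps_isometry_on states \<delta> \<epsilon> T \<longrightarrow>
      (\<exists>U. (unitary U \<or> antiunitary U) \<and> (\<forall>\<rho>\<in>states. \<delta> (T \<rho>) (conjugate_by U \<rho>) \<le> \<omega> \<epsilon>)))"
proof -
  define good where "good \<epsilon> \<eta> \<longleftrightarrow> 0 \<le> \<eta> \<and> (\<forall>T. eps_isometry_on states \<delta> \<epsilon> T \<longrightarrow>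
      (\<exists>U. (unitary U \<or> antiunitary U) \<and> (\<forall>\<rho>\<in>states. \<delta> (T \<rho>) (conjugate_by U \<rho>) \<le> \<eta>)))" for \<epsilon> \<eta>
  obtain B where B: "0 \<le> B" "\<And>\<rho> \<sigma>. \<rho> \<in> states \<Longrightarrow> \<sigma> \<in> states \<Longrightarrow> \<delta> \<rho> \<sigma> \<le> B"
    using bounded_on_states by blast
  have "unitary (id :: complex ^ 'n \<Rightarrow> complex ^ 'n)"
    by (simp add: unitary_def vec.linear_id)
  moreover have "conjugate_by id \<rho> = \<rho>" for \<rho> :: "complex ^ 'n ^ 'n"
    by (simp add: conjugate_by_def inv_id)
  ultimately have good_B: "good \<epsilon> B" for \<epsilon>
    using B by (auto simp: good_def eps_isometry_on_def Pi_iff intro!: exI[of _ id])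
  \<comment> \<open>The infimum need not be attained; adding \<open>\<epsilon>\<close> leaves room for a good value below. This room
    vanishes at \<open>0\<close>, where the diameter bound serves.\<close>
  define \<omega> where "\<omega> \<epsilon> = (if \<epsilon> = 0 then B else Inf {\<eta>. good \<epsilon> \<eta>} + \<epsilon>)" for \<epsilon>
  have bdd: "bdd_below {\<eta>. good \<epsilon> \<eta>}" for \<epsilon>
    by (rule bdd_belowI[of _ 0]) (simp add: good_def)
  have Inf_nonneg: "0 \<le> Inf {\<eta>. good \<epsilon> \<eta>}" for \<epsilon>
    using good_B by (intro cInf_greatest) (auto simp: good_def)
  have good_\<omega>: "good \<epsilon> (\<omega> \<epsilon>)" if "0 \<le> \<epsilon>" for \<epsilon>
  proof (cases "\<epsilon> = 0")
    case True
    then show ?thesis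
      using good_B by (simp add: \<omega>_def)
  next
    case False
    then have "Inf {\<eta>. good \<epsilon> \<eta>} < \<omega> \<epsilon>"
      using that by (simp add: \<omega>_def)
    then obtain \<eta> where "good \<epsilon> \<eta>" "\<eta> < \<omega> \<epsilon>"
      using cInf_lessD[of "{\<eta>. good \<epsilon> \<eta>}"] good_B by blast
    then show ?thesis
      unfolding good_def by (meson less_imp_le order_trans)
  qed
  have "(\<omega> \<longlongrightarrow> 0) (at_right 0)"
  proof (rule tendstoI)
    fix e :: real
    assume e: "0 < e"
    then obtain \<epsilon>\<^sub>0 where \<epsilon>\<^sub>0: "0 < \<epsilon>\<^sub>0" "\<And>\<epsilon>. \<epsilon> \<le> \<epsilon>\<^sub>0 \<Longrightarrow> good \<epsilon> (e / 2)"
      using near_isometry_stable[of "e / 2"] by (auto simp: good_def)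
    have "dist (\<omega> \<epsilon>) 0 < e" if "0 < \<epsilon>" "\<epsilon> < min \<epsilon>\<^sub>0 (e / 2)" for \<epsilon>
    proof -
      have "Inf {\<eta>. good \<epsilon> \<eta>} \<le> e / 2"
        using that \<epsilon>\<^sub>0(2)[of \<epsilon>] by (intro cInf_lower bdd) auto
      then show ?thesis
        using that Inf_nonneg[of \<epsilon>] by (simp add: \<omega>_def dist_real_def)
    qed
    then show "eventually (\<lambda>\<epsilon>. dist (\<omega> \<epsilon>) 0 < e) (at_right 0)"
      unfolding eventually_at_right_field using e \<epsilon>\<^sub>0(1) by (intro exI[of _ "min \<epsilon>\<^sub>0 (e / 2)"]) auto
  qed
  then show ?thesis
    using good_\<omega> by (intro exI[of _ \<omega>]) (auto simp: good_def)
qed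

end

lemma pure_state_metric_trace: "pure_state_metric trace_dist 2"
proof
  fix x y x' y' :: "complex ^ 'n"
  assume "norm x = 1" "norm y = 1" "norm x' = 1" "norm y' = 1"
    "trace_dist (proj x) (proj y) = trace_dist (proj x') (proj y')"
  then have "(cmod (cinner x y))\<^sup>2 = (cmod (cinner x' y'))\<^sup>2"
    by (simp add: trace_dist_proj_proj)
  then show "cmod (cinner x y) = cmod (cinner x' y')"
    by simp
qed (simp_all add: trace_dist_self continuous_on_trace_dist trace_dist_eq_2_iff trace_dist_determines)

lemma pure_state_metric_bures: "pure_state_metric bures_dist (sqrt 2)"
proof
  fix x y x' y' :: "complex ^ 'n"
  assume "norm x = 1" "norm y = 1" "norm x' = 1" "norm y' = 1"
    "bures_dist (proj x) (proj y) = bures_dist (proj x') (proj y')"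
  then show "cmod (cinner x y) = cmod (cinner x' y')"
    by (simp add: bures_dist_proj_proj)
qed (simp_all add: bures_dist_self continuous_on_bures_dist bures_dist_eq_sqrt2_iff bures_dist_determines)

theorem corollary1p6:
  fixes \<delta> :: "complex ^ 'n ^ 'n \<Rightarrow> complex ^ 'n ^ 'n \<Rightarrow> real"
  assumes "\<delta> \<in> {bures_dist, trace_dist}"
  shows "\<exists>\<omega> :: real \<Rightarrow> real.
    (\<forall>\<epsilon>\<ge>0. 0 \<le> \<omega> \<epsilon>) \<and> (\<omega> \<longlongrightarrow> 0) (at_right 0) \<and>
    (\<forall>\<epsilon>\<ge>0. \<forall>T. eps_isometry_on states \<delta> \<epsilon> T \<and> T ` states = states \<longrightarrow>
      (\<exists>U. (unitary U \<or> antiunitary U) \<and>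
        (SUP \<rho>\<in>states. ereal (\<delta> (T \<rho>) (conjugate_by U \<rho>))) \<le> ereal (\<omega> \<epsilon>)))"
proof -
  have "\<exists>m. pure_state_metric \<delta> m"
    using assms pure_state_metric_bures pure_state_metric_trace by auto
  then obtain \<omega> where \<omega>: "\<forall>\<epsilon>\<ge>0. 0 \<le> \<omega> \<epsilon>" "(\<omega> \<longlongrightarrow> 0) (at_right (0::real))"
    "\<And>\<epsilon> T. 0 \<le> \<epsilon> \<Longrightarrow> eps_isometry_on states \<delta> \<epsilon> T \<Longrightarrow>
      \<exists>U. (unitary U \<or> antiunitary U) \<and> (\<forall>\<rho>\<in>states. \<delta> (T \<rho>) (conjugate_by U \<rho>) \<le> \<omega> \<epsilon>)"
    using pure_state_metric.stability_modulus by metis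
  have "\<exists>U. (unitary U \<or> antiunitary U) \<and>
      (SUP \<rho>\<in>states. ereal (\<delta> (T \<rho>) (conjugate_by U \<rho>))) \<le> ereal (\<omega> \<epsilon>)"
    if T: "0 \<le> \<epsilon>" "eps_isometry_on states \<delta> \<epsilon> T" for \<epsilon> T
  proof -
    obtain U where "unitary U \<or> antiunitary U"
      "\<forall>\<rho>\<in>states. \<delta> (T \<rho>) (conjugate_by U \<rho>) \<le> \<omega> \<epsilon>"
      using \<omega>(3)[OF T] by blast
    then show ?thesis
      by (intro exI[of _ U] conjI SUP_least) auto
  qed
  then show ?thesis
    using \<omega>(1,2) by (intro exI[of _ \<omega>]) blast
qed

end
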